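(* For each $d\in\mathbb N$ with $d\geq 2$, there exists a representation of $\mathbb R^d$ as a union of hairs with the following properties: (i) the intersection of any two distinct hairs of the family is either empty or consists of exactly one point, which is the endpoint of both hairs; (ii) the union of the hairs with their endpoints removed has Hausdorff dimension $1$.
   Context: A subset $H\subset\mathbb R^d$ is called a hair if there exists a continuous injective map $\gamma:[0,\infty)\to\mathbb R^d$ with $\lim_{t\to\infty}\gamma(t)=\infty$ (i.e. $\|\gamma(t)\|\to\infty$) and $\gamma([0,\infty))=H$; the point $\gamma(0)$ is called the endpoint of the hair. *)

theory Defs
  imports "HOL-Analysis.Analysis"
begin

definition hair_param :: "(real \<Rightarrow> 'a::real_normed_vector) \<Rightarrow> bool" where
  "hair_param g \<longleftrightarrow> continuous_on {0..} g \<and> inj_on g {0..} \<and>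
     filterlim (\<lambda>t. norm (g t)) at_top at_top"

definition hair_with_endpoint :: "'a::real_normed_vector set \<Rightarrow> 'a \<Rightarrow> bool" where
  "hair_with_endpoint H p \<longleftrightarrow> (\<exists>g. hair_param g \<and> g ` {0..} = H \<and> g 0 = p)"

definition is_hair :: "'a::real_normed_vector set \<Rightarrow> bool" where
  "is_hair H \<longleftrightarrow> (\<exists>p. hair_with_endpoint H p)"

definition hausdorff_pre :: "real \<Rightarrow> real \<Rightarrow> 'a::metric_space set \<Rightarrow> ennreal" where
  "hausdorff_pre s \<delta> A =
     (INF C \<in> {C :: nat \<Rightarrow> 'a set. A \<subseteq> (\<Union>i. C i) \<and> (\<forall>i. bounded (C i) \<and> diameter (C i) \<le> \<delta>)}.
        (\<Sum>i. ennreal (diameter (C i) powr s)))"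

definition hausdorff_measure :: "real \<Rightarrow> 'a::metric_space set \<Rightarrow> ennreal" where
  "hausdorff_measure s A = (SUP \<delta> \<in> {0<..}. hausdorff_pre s \<delta> A)"

definition hausdorff_dim :: "'a::metric_space set \<Rightarrow> ereal" where
  "hausdorff_dim A = Inf (ereal ` {s. s \<ge> 0 \<and> hausdorff_measure s A = 0})"

end

theory Submission
  imports Defs
begin

text \<open>
  The hairs come from the dynamics of an explicit analogue of the sine function. Tile the closed upper
  half-space by vertical half-beams over lateral cubes of side 2. The folding map \<open>wrap\<close> maps each
  half-beam bijectively onto the half-space, expands distances by a factor of at least 2, grows
  exponentially in the height, and sends the walls and floors of the half-beams into the hyperplane
  \<open>ht = 0\<close>. The hairs are the nonempty sets \<open>itin s\<close> of points whose orbit follows a given sequence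
  \<open>s\<close> of half-beams, together with their mirror images in the lower half-space.

  The potential \<open>pot x\<close> measures how fast the height of the orbit of \<open>x\<close> grows. On a nonempty set
  \<open>itin s\<close>, it is continuous, injective and proper, and its image is a closed half-line; its inverse
  parametrises the hair. The orbit of a point with two itineraries reaches \<open>ht = 0\<close>, so its potential
  is 0 and it is the endpoint of both hairs.

  Let \<open>x\<close> lie on a hair but not be its endpoint. The orbit of the endpoint has the same itinerary and
  grows much more slowly, hence the lateral position of the orbit of \<open>x\<close> is eventually negligible
  against any positive power of its height. Near height \<open>m\<close>, the inverse branches contract by a factor
  of order \<open>1 / m\<close>, so such points have measure zero in every dimension above 1.
\<close>

subsection \<open>The folding map\<close>

text \<open>\<open>'n\<close> has no distinguished element, so an arbitrary coordinate is chosen to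
  be the vertical one.\<close>

definition vert :: "'n::finite" where "vert = (SOME i. True)"

definition ht :: "real^'n::finite \<Rightarrow> real" where "ht x = x $ vert"

text \<open>The sup norm is used because its balls are the cubes of the tiling. Blanking the
  vertical entry instead of dropping it keeps all vectors in \<open>real^'n\<close>.\<close>

definition lat :: "real^'n::finite \<Rightarrow> real" where
  "lat x = infnorm (\<chi> i. if i = vert then 0 else x $ i)"

text \<open>The closed upper half-space is foliated by the sets \<open>level y = 8 * c\<close> with \<open>c \<ge> 0\<close>, each of which
  consists of a flat top and vertical sides; for \<open>c = 0\<close> the sides are degenerate.\<close>

definition level :: "real^'n::finite \<Rightarrow> real" where
  "level x = max (lat x - 8) (ht x)"

lemma infnorm_le_iff: "infnorm (x::real^'n::finite) \<le> B \<longleftrightarrow> (\<forall>i. \<bar>x $ i\<bar> \<le> B)"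
proof
  assume "infnorm x \<le> B" then show "\<forall>i. \<bar>x $ i\<bar> \<le> B"
    using component_le_infnorm_cart order_trans by blast
next
  assume "\<forall>i. \<bar>x $ i\<bar> \<le> B" then show "infnorm x \<le> B"
    unfolding infnorm_cart by (intro cSup_least) auto
qed

lemma lat_nonneg [simp]: "0 \<le> lat x"
  by (simp add: lat_def infnorm_pos_le)

lemma lat_le_iff: "0 \<le> B \<Longrightarrow> lat x \<le> B \<longleftrightarrow> (\<forall>i. i \<noteq> vert \<longrightarrow> \<bar>x $ i\<bar> \<le> B)"
  by (auto simp: lat_def infnorm_le_iff)

lemma component_le_lat: "i \<noteq> vert \<Longrightarrow> \<bar>x $ i\<bar> \<le> lat x"
  using lat_le_iff[of "lat x" x] by simp

lemma abs_ht_le_infnorm: "\<bar>ht x\<bar> \<le> infnorm x"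
  by (simp add: ht_def component_le_infnorm_cart)

lemma lat_le_infnorm: "lat x \<le> infnorm x"
  by (simp add: lat_le_iff infnorm_pos_le component_le_infnorm_cart)

lemma infnorm_le_lat_ht:
  assumes "lat x \<le> B" "\<bar>ht x\<bar> \<le> B" shows "infnorm x \<le> B"
  unfolding infnorm_le_iff
proof
  fix i show "\<bar>x $ i\<bar> \<le> B"
    using assms component_le_lat[of i x] by (cases "i = vert") (auto simp: ht_def)
qed

lemma lat_scale:
  assumes "\<And>i. i \<noteq> vert \<Longrightarrow> y $ i = k * x $ i"
  shows "lat y = \<bar>k\<bar> * lat x"
proof -
  have "(\<chi> i. if i = vert then 0 else y $ i) = k *\<^sub>R (\<chi> i. if i = vert then 0 else x $ i)"
    using assms by (auto simp: vec_eq_iff)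
  then show ?thesis by (simp add: lat_def infnorm_mul)
qed

lemma abs_lat_diff: "\<bar>lat x - lat y\<bar> \<le> lat (x - y)"
proof -
  have "(\<chi> i. if i = vert then 0 else (x - y) $ i)
      = (\<chi> i. if i = vert then 0 else x $ i) - (\<chi> i. if i = vert then 0 else y $ i)"
    by (auto simp: vec_eq_iff)
  then show ?thesis unfolding lat_def by (simp only: absdiff_infnorm)
qed

lemma ht_diff: "ht (x - y) = ht x - ht y" by (simp add: ht_def)

lemma abs_level_diff: "\<bar>level x - level y\<bar> \<le> infnorm (x - y)"
  using abs_lat_diff[of x y] lat_le_infnorm[of "x - y"] abs_ht_le_infnorm[of "x - y"]
  unfolding level_def ht_diff by linarith

lemma continuous_on_ht [continuous_intros]:
  "continuous_on S f \<Longrightarrow> continuous_on S (\<lambda>x. ht (f x))"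
  unfolding ht_def by (intro continuous_intros)

lemma continuous_on_lat [continuous_intros]:
  assumes "continuous_on S f" shows "continuous_on S (\<lambda>x. lat (f x))"
proof -
  have "continuous_on UNIV (lat :: real^'n \<Rightarrow> real)"
  proof (rule lipschitz_on_continuous_on)
    show "1-lipschitz_on UNIV (lat :: real^'n \<Rightarrow> real)"
    proof (rule lipschitz_onI)
      fix x y :: "real^'n"
      show "dist (lat x) (lat y) \<le> 1 * dist x y"
        using abs_lat_diff[of x y] lat_le_infnorm[of "x - y"] infnorm_le_norm[of "x - y"]
        by (simp add: dist_norm)
    qed simp
  qed
  then show ?thesis by (rule continuous_on_compose2[OF _ assms subset_UNIV])
qed

lemma continuous_on_level [continuous_intros]:
  "continuous_on S f \<Longrightarrow> continuous_on S (\<lambda>x. level (f x))"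
  unfolding level_def by (intro continuous_intros)

text \<open>On the half-beam \<open>lat x \<le> 1\<close>, \<open>0 \<le> ht x\<close> this is a bijection onto the closed upper half-space
  with inverse \<open>rollup\<close>. The horizontal section at height \<open>h\<close> goes to the level set with
  \<open>c = exp h - 1\<close>, its boundary being mapped to the hyperplane \<open>ht = 0\<close>.\<close>

definition unroll :: "real^'n::finite \<Rightarrow> real^'n" where
  "unroll x = (let c = exp (ht x) - 1; v = lat x in
     \<chi> i. if i = vert then 8 * min c ((1 + 2 * c) * (1 - v))
         else 8 * (1 + c) / max v ((1 + c) / (1 + 2 * c)) * x $ i)"

definition rollup :: "real^'n::finite \<Rightarrow> real^'n" where
  "rollup y = (let c = level y / 8; t = ht y / 8 in
     \<chi> i. if i = vert then ln (1 + c)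
         else (1 + 2 * c - t) / ((1 + c) * (1 + 2 * c)) * (y $ i / 8))"

text \<open>The two cases are the two pieces of a level set. The inner cube
  \<open>lat x \<le> (1 + c) / (1 + 2 * c)\<close> is scaled onto the flat top. On the frame around
  it the image has constant \<open>lat\<close>, namely \<open>8 * (1 + c)\<close>, and its height
  falls linearly in \<open>lat x\<close> from \<open>8 * c\<close> to 0.\<close>

lemma unroll_facts:
  assumes h: "0 \<le> ht x" and v: "lat x \<le> 1"
  shows "ht (unroll x) \<ge> 0" "level (unroll x) = 8 * (exp (ht x) - 1)" "rollup (unroll x) = x"
proof -
  define c where "c = exp (ht x) - 1"
  have c: "0 \<le> c" using h by (simp add: c_def)
  define d where "d = max (lat x) ((1 + c) / (1 + 2 * c))"
  have pos: "0 < (1 + c) / (1 + 2 * c)" using c by simp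
  then have d: "0 < d" by (simp add: d_def)
  have lc: "unroll x $ i = 8 * (1 + c) / d * x $ i" if "i \<noteq> vert" for i
    using that by (simp add: unroll_def c_def d_def Let_def)
  have lat: "lat (unroll x) = 8 * (1 + c) / d * lat x"
    using lat_scale[OF lc] c d by simp
  have ht: "ht (unroll x) = 8 * min c ((1 + 2 * c) * (1 - lat x))"
    by (simp add: unroll_def ht_def c_def Let_def)
  have "0 \<le> (1 + 2 * c) * (1 - lat x)" using c v by (intro mult_nonneg_nonneg) auto
  then show "ht (unroll x) \<ge> 0" using ht c by simp
  \<comment> \<open>The second conjunct says that the lateral factors of \<open>rollup\<close> and
    \<open>unroll\<close> are inverse to each other; the constants 8 and 1/8 are left out.\<close>
  have lev: "level (unroll x) = 8 * c \<and> (1 + 2 * c - ht (unroll x) / 8) / ((1 + c) * (1 + 2 * c)) * ((1 + c) / d) = 1"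
  proof (cases "lat x \<le> (1 + c) / (1 + 2 * c)")
    case True
    then have de: "d = (1 + c) / (1 + 2 * c)" by (simp add: d_def)
    have T: "lat x * (1 + 2 * c) \<le> 1 + c" using True c by (simp add: pos_le_divide_eq)
    have "(1 + c) / d = 1 + 2 * c" using c by (simp add: de)
    then have l: "lat (unroll x) = 8 * (lat x * (1 + 2 * c))" unfolding lat times_divide_eq_right[symmetric] by simp
    have "c \<le> (1 + 2 * c) * (1 - lat x)" using T by (simp add: algebra_simps)
    then have t: "ht (unroll x) = 8 * c" using ht by simp
    have "level (unroll x) = 8 * c" using l t T by (simp add: level_def)
    moreover have "(1 + 2 * c - ht (unroll x) / 8) / ((1 + c) * (1 + 2 * c)) * ((1 + c) / d) = 1"
    proof -
      have "1 + 2 * c - ht (unroll x) / 8 = 1 + c" using t by simp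
      moreover have "(1 + c) / ((1 + c) * (1 + 2 * c)) * (1 + 2 * c) = 1" using c by simp
      ultimately show ?thesis using \<open>(1 + c) / d = 1 + 2 * c\<close> by (simp only:)
    qed
    ultimately show ?thesis by (rule conjI)
  next
    case False
    then have de: "d = lat x" and lp: "0 < lat x" using pos by (simp_all add: d_def)
    have T: "lat x * (1 + 2 * c) > 1 + c" using False c by (simp add: not_le pos_divide_less_eq)
    have l: "lat (unroll x) = 8 * (1 + c)" using lp by (simp add: lat de)
    have le: "(1 + 2 * c) * (1 - lat x) \<le> c" using T by (simp add: algebra_simps)
    then have t: "ht (unroll x) = 8 * ((1 + 2 * c) * (1 - lat x))" using ht by simp
    have "level (unroll x) = 8 * c" using l t le by (simp add: level_def)
    moreover have "(1 + 2 * c - ht (unroll x) / 8) / ((1 + c) * (1 + 2 * c)) * ((1 + c) / d) = 1"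
    proof -
      have "1 + 2 * c - ht (unroll x) / 8 = (1 + 2 * c) * lat x" using t by (simp add: algebra_simps)
      moreover have "(1 + 2 * c) * lat x / ((1 + c) * (1 + 2 * c)) * ((1 + c) / lat x) = 1"
        using c lp by simp
      ultimately show ?thesis by (simp only: de)
    qed
    ultimately show ?thesis by (rule conjI)
  qed
  note lev1 = conjunct1[OF lev]
  then show "level (unroll x) = 8 * (exp (ht x) - 1)" by (simp add: c_def)
  have cancel: "p * (q * w) = w" if "p * q = 1" for p q w :: real
    using that by (simp flip: mult.assoc)
  have "rollup (unroll x) $ i = x $ i" for i
  proof (cases "i = vert")
    case True
    then show ?thesis using lev1 by (simp add: rollup_def Let_def) (simp add: c_def ht_def)
  next
    case False
    have "rollup (unroll x) $ i = (1 + 2 * c - ht (unroll x) / 8) / ((1 + c) * (1 + 2 * c)) * (unroll x $ i / 8)"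
      using False lev1 by (simp add: rollup_def Let_def)
    also have "unroll x $ i / 8 = ((1 + c) / d) * x $ i"
      using lc[OF False] unfolding times_divide_eq_right[symmetric] by linarith
    also have "(1 + 2 * c - ht (unroll x) / 8) / ((1 + c) * (1 + 2 * c)) * ((1 + c) / d * x $ i) = x $ i"
      by (rule cancel[OF conjunct2[OF lev]])
    finally show ?thesis .
  qed
  then show "rollup (unroll x) = x" by (simp add: vec_eq_iff)
qed

lemma rollup_facts:
  assumes "0 \<le> ht y"
  shows "0 \<le> ht (rollup y)" "lat (rollup y) \<le> 1" "unroll (rollup y) = y"
proof -
  define c where "c = level y / 8"
  define t where "t = ht y / 8"
  define m where "m = lat y / 8"
  have cm: "c = max (m - 1) t" by (simp add: c_def level_def m_def t_def max_def)
  have t: "0 \<le> t" using assms by (simp add: t_def)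
  have c: "0 \<le> c" "t \<le> c" "m \<le> 1 + c" using t cm by auto
  have m0: "0 \<le> m" by (simp add: m_def)
  define k where "k = (1 + 2 * c - t) / ((1 + c) * (1 + 2 * c))"
  have k: "0 < k" using c by (simp add: k_def)
  have lc: "rollup y $ i = (k / 8) * y $ i" if "i \<noteq> vert" for i
    using that by (simp add: rollup_def k_def c_def t_def Let_def)
  have lat: "lat (rollup y) = k * m" using lat_scale[OF lc] k by (simp add: m_def)
  have ht: "ht (rollup y) = ln (1 + c)" by (simp add: rollup_def ht_def c_def Let_def)
  then show "0 \<le> ht (rollup y)" using c by simp
  have ex: "exp (ht (rollup y)) - 1 = c" using ht c by simp
  define d where "d = max (k * m) ((1 + c) / (1 + 2 * c))"
  \<comment> \<open>If \<open>t = c\<close>, then \<open>y\<close> lies on the flat top of its level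
    set. Otherwise the maximum in \<open>cm\<close> is attained by \<open>m - 1\<close>, and
    \<open>y\<close> lies on the vertical sides.\<close>
  have main: "k * m \<le> 1 \<and> (1 + c) / d * k = 1 \<and> min c ((1 + 2 * c) * (1 - k * m)) = t"
  proof (cases "t = c")
    case True
    have k1: "k = 1 / (1 + 2 * c)" using c by (simp add: k_def True add.commute)
    have le: "k * m \<le> (1 + c) / (1 + 2 * c)" using c by (simp add: k1 divide_right_mono)
    then have d: "d = (1 + c) / (1 + 2 * c)" by (simp add: d_def)
    have "(1 + c) / (1 + 2 * c) \<le> 1" using c by simp
    moreover have "(1 + 2 * c) * (1 - k * m) = 1 + 2 * c - m" using c by (simp add: k1 field_simps)
    ultimately show ?thesis using le c True by (auto simp: d k1)
  next
    case False
    then have m: "m = 1 + c" using cm c by (auto simp: max_def split: if_splits)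
    have km: "k * m = (1 + 2 * c - t) / (1 + 2 * c)" using c by (simp add: k_def m)
    have "(1 + c) / (1 + 2 * c) \<le> k * m" unfolding km using c by (intro divide_right_mono) auto
    then have d: "d = k * m" by (simp add: d_def)
    have "(1 + 2 * c) * (1 - k * m) = t" using c by (simp add: km field_simps)
    moreover have "k * m \<le> 1" using c t by (simp add: km)
    moreover have "(1 + c) / d * k = 1" using k c by (simp add: d m)
    ultimately show ?thesis using c by auto
  qed
  then show "lat (rollup y) \<le> 1" using lat by simp
  have alg: "8 * q * (k / 8 * w) = q * k * w" for q w :: real by simp
  have "unroll (rollup y) $ i = y $ i" for i
  proof (cases "i = vert")
    case True
    then show ?thesis using main
      by (simp add: unroll_def ex lat Let_def) (simp add: t_def ht_def)
  next
    case False
    have "unroll (rollup y) $ i = 8 * (1 + c) / d * rollup y $ i"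
      using False by (simp add: unroll_def ex lat d_def Let_def)
    also have "\<dots> = 8 * ((1 + c) / d) * (k / 8 * y $ i)"
      unfolding lc[OF False] times_divide_eq_right ..
    also have "\<dots> = (1 + c) / d * k * y $ i"
      using alg .
    also have "\<dots> = y $ i" using conjunct1[OF conjunct2[OF main]] by (simp only: mult_1)
    finally show ?thesis .
  qed
  then show "unroll (rollup y) = y" by (simp add: vec_eq_iff)
qed

text \<open>Write the difference as \<open>(a - b) / c + b / e * ((e - c) / c)\<close>; the factor
  \<open>b / e\<close> has modulus at most 1. Only one of the two denominators survives.\<close>

lemma abs_divide_diff_le:
  fixes a b c e :: real
  assumes "0 < c" "0 < e" "\<bar>b\<bar> \<le> e"
  shows "\<bar>a / c - b / e\<bar> \<le> (\<bar>a - b\<bar> + \<bar>c - e\<bar>) / c"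
proof -
  have "a / c - b / e = (a - b) / c + b / e * ((e - c) / c)"
    using assms by (simp add: field_simps)
  moreover have "\<bar>b / e * ((e - c) / c)\<bar> \<le> 1 * \<bar>(e - c) / c\<bar>"
    unfolding abs_mult using assms by (intro mult_right_mono) auto
  ultimately have "\<bar>a / c - b / e\<bar> \<le> \<bar>(a - b) / c\<bar> + \<bar>(e - c) / c\<bar>" by linarith
  also have "\<dots> = (\<bar>a - b\<bar> + \<bar>c - e\<bar>) / c"
    using assms by (simp add: add_divide_distrib abs_minus_commute)
  finally show ?thesis .
qed

text \<open>After division by 8, every lateral coordinate is a product of two factors of modulus at
  most 1, each of which moves by at most \<open>2 * \<delta> / (1 + c)\<close>. The constant is 1/2
  at level 0, which gives uniform expansion of \<open>wrap\<close>, and decays like the reciprocal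
  of the level, which gives the dimension bound.\<close>

lemma rollup_lipschitz:
  assumes "0 \<le> ht y" "0 \<le> ht z"
  shows "infnorm (rollup y - rollup z) \<le> 4 / (8 + min (level y) (level z)) * infnorm (y - z)"
proof -
  define \<delta> where "\<delta> = infnorm (y - z) / 8"
  define c where "c = level y / 8"
  define e where "e = level z / 8"
  define t where "t = ht y / 8"
  define u where "u = ht z / 8"
  have t: "0 \<le> t" "t \<le> c" "0 \<le> u" "u \<le> e" "lat y / 8 \<le> 1 + c" "lat z / 8 \<le> 1 + e"
    using assms by (auto simp: c_def e_def t_def u_def level_def)
  have d: "\<bar>c - e\<bar> \<le> \<delta>" "\<bar>t - u\<bar> \<le> \<delta>"
    using abs_level_diff[of y z] abs_ht_le_infnorm[of "y - z"]
    unfolding c_def e_def t_def u_def \<delta>_def ht_diff by linarith+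
  have bound: "4 / (8 + min (level y) (level z)) * infnorm (y - z) = 4 * \<delta> / (1 + min c e)"
  proof -
    have "8 + min (level y) (level z) = 8 * (1 + min c e)" by (auto simp: c_def e_def min_def)
    moreover have "4 / (8 * m) * w = 4 * (w / 8) / m" for m w :: real by simp
    ultimately show ?thesis unfolding \<delta>_def by metis
  qed
  have \<delta>: "0 \<le> \<delta>" using d by linarith
  have mn: "0 < 1 + min c e" using t by auto
  have up: "B / (1 + c) \<le> B / (1 + min c e)" if "0 \<le> B" for B
    using mn t that by (intro divide_left_mono) auto
  have "\<bar>(rollup y - rollup z) $ i\<bar> \<le> 4 * \<delta> / (1 + min c e)" for i
  proof (cases "i = vert")
    case True
    have ln_le: "ln (1 + b) - ln (1 + a) \<le> (b - a) / (1 + a)" if "0 \<le> a" "a \<le> b" for a b :: real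
      using ln_le_minus_one[of "(1 + b) / (1 + a)"] that by (simp add: ln_div field_simps)
    have "\<bar>ln (1 + c) - ln (1 + e)\<bar> \<le> \<bar>c - e\<bar> / (1 + min c e)"
    proof (cases "c \<le> e")
      case True then show ?thesis using ln_le[of c e] t by (simp add: min_def)
    next
      case False then show ?thesis using ln_le[of e c] t by (simp add: min_def)
    qed
    also have "\<dots> \<le> 4 * \<delta> / (1 + min c e)" using d mn by (intro divide_right_mono) auto
    finally show ?thesis using True by (simp add: rollup_def c_def e_def Let_def)
  next
    case False
    define a where "a = y $ i / 8"
    define b where "b = z $ i / 8"
    have ab: "\<bar>a\<bar> \<le> 1 + c" "\<bar>b\<bar> \<le> 1 + e"
      using component_le_lat[OF False, of y] component_le_lat[OF False, of z] t
      by (auto simp: a_def b_def)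
    have dab: "\<bar>a - b\<bar> \<le> \<delta>"
      using component_le_infnorm_cart[of "y - z" i]
      unfolding a_def b_def \<delta>_def vector_minus_component by linarith
    define p q p' q' where "p = a / (1 + c)" and "q = 1 - t / (1 + 2 * c)"
      and "p' = b / (1 + e)" and "q' = 1 - u / (1 + 2 * e)"
    have "\<bar>p - p'\<bar> \<le> (\<bar>a - b\<bar> + \<bar>(1 + c) - (1 + e)\<bar>) / (1 + c)"
      unfolding p_def p'_def using t ab by (intro abs_divide_diff_le) auto
    also have "\<dots> \<le> 2 * \<delta> / (1 + c)" using dab d t by (intro divide_right_mono) auto
    finally have dp: "\<bar>p - p'\<bar> \<le> 2 * \<delta> / (1 + c)" .
    \<comment> \<open>The doubled numerators still satisfy \<open>2 * u \<le> 1 + 2 * e\<close>, and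
      halving afterwards yields \<open>2 * \<delta>\<close> where the undoubled ones would yield
      \<open>3 * \<delta>\<close>.\<close>
    have "\<bar>2 * t / (1 + 2 * c) - 2 * u / (1 + 2 * e)\<bar>
        \<le> (\<bar>2 * t - 2 * u\<bar> + \<bar>(1 + 2 * c) - (1 + 2 * e)\<bar>) / (1 + 2 * c)"
      using t by (intro abs_divide_diff_le) auto
    also have "\<dots> \<le> 4 * \<delta> / (1 + c)" using d t by (intro frac_le) auto
    finally have dq: "\<bar>q - q'\<bar> \<le> 2 * \<delta> / (1 + c)" by (simp add: q_def q'_def)
    have q: "\<bar>q\<bar> \<le> 1" using t by (simp add: q_def abs_if)
    have p': "\<bar>p'\<bar> \<le> 1" using t ab by (simp add: p'_def)
    have "p * q - p' * q' = (p - p') * q + p' * (q - q')" by (simp add: algebra_simps)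
    then have "\<bar>p * q - p' * q'\<bar> \<le> \<bar>p - p'\<bar> * \<bar>q\<bar> + \<bar>p'\<bar> * \<bar>q - q'\<bar>"
      by (metis abs_mult abs_triangle_ineq)
    also have "\<dots> \<le> \<bar>p - p'\<bar> * 1 + 1 * \<bar>q - q'\<bar>" using q p' by (intro add_mono mult_mono) auto
    also have "\<dots> \<le> 4 * \<delta> / (1 + c)" using dp dq by simp
    also have "\<dots> \<le> 4 * \<delta> / (1 + min c e)" using up \<delta> by simp
    finally have "\<bar>p * q - p' * q'\<bar> \<le> 4 * \<delta> / (1 + min c e)" .
    moreover have "rollup y $ i = p * q"
      using False t by (simp add: rollup_def Let_def p_def q_def a_def flip: c_def t_def)
        (simp add: field_simps)
    moreover have "rollup z $ i = p' * q'"
      using False t by (simp add: rollup_def Let_def p'_def q'_def b_def flip: e_def u_def)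
        (simp add: field_simps)
    ultimately show ?thesis by simp
  qed
  then show ?thesis unfolding bound infnorm_le_iff by blast
qed

lemma continuous_on_unroll: "continuous_on {x :: real^'n::finite. 0 \<le> ht x} unroll"
proof -
  have p: "0 < 1 + 2 * (exp (ht x) - 1)" if "0 \<le> ht x" for x :: "real^'n"
  proof -
    have "1 \<le> exp (ht x)" using that by simp
    then show ?thesis unfolding right_diff_distrib by linarith
  qed
  have q: "0 < max (lat x) ((1 + (exp (ht x) - 1)) / (1 + 2 * (exp (ht x) - 1)))"
    if "0 \<le> ht x" for x :: "real^'n"
    unfolding less_max_iff_disj using p[OF that] by simp
  show ?thesis unfolding unroll_def Let_def
  proof (rule continuous_on_vec_lambda)
    fix i :: "'n"
    have ne: "1 + 2 * (exp (ht x) - 1) \<noteq> 0"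
      "max (lat x) ((1 + (exp (ht x) - 1)) / (1 + 2 * (exp (ht x) - 1))) \<noteq> 0"
      if "x \<in> {x. 0 \<le> ht x}" for x :: "real^'n"
      using p[of x] q[of x] that by (metis less_irrefl mem_Collect_eq)+
    show "continuous_on {x. 0 \<le> ht x} (\<lambda>x. if i = vert
        then 8 * min (exp (ht x) - 1) ((1 + 2 * (exp (ht x) - 1)) * (1 - lat x))
        else 8 * (1 + (exp (ht x) - 1))
          / max (lat x) ((1 + (exp (ht x) - 1)) / (1 + 2 * (exp (ht x) - 1))) * x $ i)"
    proof (cases "i = vert")
      case True
      show ?thesis unfolding if_P[OF True] by (intro continuous_intros)
    next
      case False
      show ?thesis unfolding if_not_P[OF False] by (intro continuous_intros ballI ne)
    qed
  qed
qed

section \<open>Triangle-wave folding and the half-beams\<close>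

definition tri :: "real \<Rightarrow> real" where "tri a = 2 / pi * arcsin (sin (pi / 2 * a))"

definition folding :: "real^'n::finite \<Rightarrow> real^'n" where
  "folding x = (\<chi> i. if i = vert then x $ i else tri (x $ i))"

text \<open>\<open>tri\<close> is the triangle wave with values in \<open>[-1, 1]\<close>, so \<open>folding\<close> maps every half-beam
  \<open>tile r\<close> isometrically onto the central one. The value \<open>r vert\<close> plays no role.\<close>

definition tile :: "('n::finite \<Rightarrow> int) \<Rightarrow> (real^'n) set" where
  "tile r = {x. 0 \<le> ht x \<and> (\<forall>i. i \<noteq> vert \<longrightarrow> \<bar>x $ i - 2 * of_int (r i)\<bar> \<le> 1)}"

definition wrap :: "real^'n::finite \<Rightarrow> real^'n" where "wrap x = unroll (folding x)"

text \<open>The slope of \<open>tri\<close> on the interval of radius 1 about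
  \<open>2 * j\<close>.\<close>

definition sgn_parity :: "int \<Rightarrow> real" where "sgn_parity j = (if even j then 1 else -1)"

lemma sin_add_int_pi: "sin (x + of_int j * pi) = sgn_parity j * sin x"
proof (induction j rule: int_induct[where k = 0])
  case (step1 j)
  then show ?case by (simp add: distrib_right sgn_parity_def flip: add.assoc)
next
  case (step2 j)
  have "sin (x + of_int j * pi) = - sin (x + of_int (j - 1) * pi)"
    by (simp add: left_diff_distrib flip: sin_periodic_pi)
  then show ?case using step2 by (auto simp: sgn_parity_def)
qed (simp add: sgn_parity_def)

lemma tri_eq:
  assumes "\<bar>a - 2 * of_int j\<bar> \<le> 1"
  shows "tri a = sgn_parity j * (a - 2 * of_int j)"
proof -
  define b where "b = a - 2 * of_int j"
  have "\<bar>pi / 2 * b\<bar> \<le> pi / 2" using assms by (simp add: abs_mult b_def)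
  then have b: "- (pi / 2) \<le> pi / 2 * b" "pi / 2 * b \<le> pi / 2" by linarith+
  have "sin (pi / 2 * a) = sin (pi / 2 * b + of_int j * pi)"
    by (simp add: b_def algebra_simps)
  also have "\<dots> = sgn_parity j * sin (pi / 2 * b)"
    by (rule sin_add_int_pi)
  finally have "sin (pi / 2 * a) = sin (sgn_parity j * (pi / 2 * b))"
    by (simp add: sgn_parity_def)
  moreover have "arcsin (sin (sgn_parity j * (pi / 2 * b))) = sgn_parity j * (pi / 2 * b)"
    using b by (intro arcsin_sin; cases "even j"; simp add: sgn_parity_def)
  ultimately have "tri a = 2 / pi * (sgn_parity j * (pi / 2 * b))" by (simp only: tri_def)
  then show ?thesis by (simp add: b_def)
qed

lemma abs_tri_le: "\<bar>tri a\<bar> \<le> 1"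
proof -
  have "\<bar>arcsin (sin (pi / 2 * a))\<bar> \<le> pi / 2"
    using arcsin_bounded[of "sin (pi / 2 * a)"] by (auto simp: abs_le_iff)
  then show ?thesis by (simp add: tri_def abs_mult field_simps)
qed

lemma ht_folding [simp]: "ht (folding x) = ht x" by (simp add: folding_def ht_def)

lemma lat_folding_le: "lat (folding x) \<le> 1" by (simp add: lat_le_iff folding_def abs_tri_le)

lemma continuous_on_folding: "continuous_on S (folding :: real^'n::finite \<Rightarrow> _)"
  unfolding folding_def tri_def
proof (rule continuous_on_vec_lambda)
  fix i :: "'n"
  show "continuous_on S (\<lambda>x. if i = vert then x $ i else 2 / pi * arcsin (sin (pi / 2 * x $ i)))"
  proof (cases "i = vert")
    case True
    show ?thesis unfolding if_P[OF True] by (intro continuous_intros)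
  next
    case False
    show ?thesis unfolding if_not_P[OF False] by (intro continuous_intros) auto
  qed
qed

lemma continuous_on_wrap: "continuous_on {x. 0 \<le> ht x} wrap"
  unfolding wrap_def by (rule continuous_on_compose2[OF continuous_on_unroll continuous_on_folding]) auto

lemma ht_wrap_nonneg: "0 \<le> ht x \<Longrightarrow> 0 \<le> ht (wrap x)"
  by (simp add: wrap_def unroll_facts lat_folding_le)

text \<open>The level reached in one step from height \<open>h\<close>. Its iterates are the scale
  on which the escape of orbits is measured.\<close>

definition growth :: "real \<Rightarrow> real" where "growth h = 8 * (exp h - 1)"

lemma level_wrap: "0 \<le> ht x \<Longrightarrow> level (wrap x) = growth (ht x)"
  by (simp add: wrap_def unroll_facts lat_folding_le growth_def)

lemma tile_ht: "x \<in> tile r \<Longrightarrow> 0 \<le> ht x" by (simp add: tile_def)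

text \<open>On a single half-beam \<open>folding\<close> does not shrink distances and
  \<open>rollup\<close> undoes \<open>unroll\<close>, so this is \<open>rollup_lipschitz\<close>
  read backwards.\<close>

lemma wrap_expanding:
  assumes "x \<in> tile r" "y \<in> tile r"
  shows "infnorm (x - y) \<le> 4 / (8 + min (level (wrap x)) (level (wrap y))) * infnorm (wrap x - wrap y)"
proof -
  have h: "0 \<le> ht x" "0 \<le> ht y" using assms by (auto simp: tile_ht)
  have "\<bar>(x - y) $ i\<bar> \<le> \<bar>(folding x - folding y) $ i\<bar>" for i
  proof (cases "i = vert")
    case False
    then show ?thesis
      using assms tri_eq[of "x $ i" "r i"] tri_eq[of "y $ i" "r i"]
      by (auto simp: tile_def folding_def sgn_parity_def)
  qed (simp add: folding_def)
  then have "infnorm (x - y) \<le> infnorm (folding x - folding y)"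
    unfolding infnorm_le_iff using component_le_infnorm_cart order_trans by blast
  also have "\<dots> = infnorm (rollup (wrap x) - rollup (wrap y))"
    using h by (simp add: wrap_def unroll_facts lat_folding_le)
  also have "\<dots> \<le> 4 / (8 + min (level (wrap x)) (level (wrap y))) * infnorm (wrap x - wrap y)"
    using h by (intro rollup_lipschitz ht_wrap_nonneg)
  finally show ?thesis .
qed

lemma level_nonneg: "0 \<le> ht x \<Longrightarrow> 0 \<le> level x" by (simp add: level_def)

lemma wrap_expanding2:
  assumes "x \<in> tile r" "y \<in> tile r"
  shows "2 * infnorm (x - y) \<le> infnorm (wrap x - wrap y)"
proof -
  have "0 \<le> min (level (wrap x)) (level (wrap y))"
    using assms by (simp add: level_nonneg ht_wrap_nonneg tile_ht)
  then have "4 / (8 + min (level (wrap x)) (level (wrap y))) \<le> 4 / 8" by (intro divide_left_mono) auto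
  then have "infnorm (x - y) \<le> 4 / 8 * infnorm (wrap x - wrap y)"
    by (intro order_trans[OF wrap_expanding[OF assms]] mult_right_mono infnorm_pos_le)
  then show ?thesis by simp
qed

lemma wrap_surj:
  assumes "0 \<le> ht y"
  shows "\<exists>x\<in>tile r. wrap x = y"
proof -
  define u where "u = rollup y"
  define x where "x = (\<chi> i. if i = vert then u $ i else 2 * of_int (r i) + sgn_parity (r i) * u $ i)"
  have u: "\<bar>u $ i\<bar> \<le> 1" if "i \<noteq> vert" for i
    using rollup_facts(2)[OF assms] component_le_lat[OF that, of u] by (simp add: u_def)
  have x: "x \<in> tile r"
    using u rollup_facts(1)[OF assms] by (auto simp: tile_def x_def ht_def u_def sgn_parity_def)
  have "folding x $ i = u $ i" for i
  proof (cases "i = vert")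
    case False
    then have "tri (x $ i) = u $ i"
      using tri_eq[of "x $ i" "r i"] x by (auto simp: tile_def x_def sgn_parity_def)
    then show ?thesis using False by (simp add: folding_def)
  qed (simp add: folding_def x_def)
  then have "folding x = u" by (simp add: vec_eq_iff)
  then have "wrap x = y" using rollup_facts(3)[OF assms] by (simp add: wrap_def u_def)
  then show ?thesis using x by blast
qed

lemma tile_cover:
  assumes "0 \<le> ht x" shows "\<exists>r. x \<in> tile r"
proof -
  have "\<bar>a - 2 * of_int (round (a / 2))\<bar> \<le> 1" for a :: real
    using of_int_round_abs_le[of "a / 2"] by linarith
  then have "x \<in> tile (\<lambda>i. round (x $ i / 2))" using assms by (simp add: tile_def)
  then show ?thesis by blast
qed

lemma tile_diff:
  assumes "x \<in> tile r" "y \<in> tile r" shows "lat (x - y) \<le> 2"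
  using assms by (force simp: lat_le_iff tile_def)

text \<open>A point of two half-beams lies on a common wall. There \<open>folding\<close> has
  lateral radius 1, and the height given by \<open>unroll\<close> is
  \<open>8 * min c 0 = 0\<close>.\<close>

lemma wrap_wall:
  assumes "x \<in> tile r" "x \<in> tile r'" "tile r \<noteq> tile r'"
  shows "ht (wrap x) = 0"
proof -
  have "tile r = tile r'" if "\<forall>i. i \<noteq> vert \<longrightarrow> r i = r' i"
    using that by (simp add: tile_def)
  then obtain i where i: "i \<noteq> vert" "r i \<noteq> r' i" using assms(3) by blast
  have a: "\<bar>x $ i - 2 * of_int (r i)\<bar> \<le> 1" "\<bar>x $ i - 2 * of_int (r' i)\<bar> \<le> 1"
    using assms i by (auto simp: tile_def)
  have "1 \<le> \<bar>real_of_int (r i) - of_int (r' i)\<bar>" using i by linarith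
  then have "\<bar>x $ i - 2 * of_int (r i)\<bar> = 1" using a by linarith
  then have "\<bar>folding x $ i\<bar> = 1" using tri_eq[OF a(1)] i by (auto simp: folding_def sgn_parity_def)
  then have "lat (folding x) = 1" using component_le_lat[OF i(1), of "folding x"] lat_folding_le[of x] by simp
  moreover have "0 \<le> ht x" using assms by (simp add: tile_ht)
  ultimately show ?thesis by (simp add: wrap_def unroll_def Let_def ht_def[of "vec_lambda _"])
qed

lemma closed_tile: "closed (tile r)"
proof -
  have "tile r = {x. 0 \<le> ht x} \<inter> (\<Inter>i\<in>-{vert}. {x. \<bar>x $ i - 2 * of_int (r i)\<bar> \<le> 1})"
    by (auto simp: tile_def)
  also have "closed \<dots>"
    by (intro closed_Int closed_INT ballI closed_Collect_le continuous_intros)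
  finally show ?thesis .
qed

subsection \<open>Potential and hairs\<close>

lemma growth_diff_ge:
  assumes "0 \<le> a" "a \<le> b" shows "8 * (b - a) \<le> growth b - growth a"
proof -
  have "1 + (b - a) \<le> exp (b - a)" by (rule exp_ge_add_one_self)
  then have "1 * (b - a) \<le> exp a * (exp (b - a) - 1)"
    using assms \<open>1 + (b - a) \<le> exp (b - a)\<close> by (intro mult_mono) (simp_all add: algebra_simps)
  also have "\<dots> = exp b - exp a" by (simp add: exp_diff algebra_simps)
  finally show ?thesis by (simp add: growth_def)
qed

lemma growth_mono_iff [simp]: "growth a < growth b \<longleftrightarrow> a < b" "growth a \<le> growth b \<longleftrightarrow> a \<le> b"
  by (simp_all add: growth_def)

lemma growth_iter_mono_iff [simp]:
  "(growth ^^ k) a < (growth ^^ k) b \<longleftrightarrow> a < b" "(growth ^^ k) a \<le> (growth ^^ k) b \<longleftrightarrow> a \<le> b"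
  by (induction k) auto

lemma growth_iter_nonneg: "0 \<le> a \<Longrightarrow> 0 \<le> (growth ^^ k) a"
  by (induction k) (auto simp: growth_def)

lemma growth_iter_diff_ge:
  assumes "0 \<le> a" "a \<le> b" shows "8 ^ k * (b - a) \<le> (growth ^^ k) b - (growth ^^ k) a"
proof (induction k)
  case (Suc k)
  have "8 ^ Suc k * (b - a) \<le> 8 * ((growth ^^ k) b - (growth ^^ k) a)" using Suc by simp
  also have "\<dots> \<le> (growth ^^ Suc k) b - (growth ^^ Suc k) a"
    using growth_diff_ge[OF growth_iter_nonneg[OF assms(1)], of k "(growth ^^ k) b"] assms by simp
  finally show ?case .
qed simp

text \<open>On the nonnegative reals \<open>growth\<close> has slope at least 8, so a positive gap
  is multiplied by at least 8 in each step and finally beats every constant.\<close>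

lemma eventually_growth_gap:
  assumes "0 \<le> a" "a < b"
  shows "eventually (\<lambda>k. (growth ^^ k) a + C \<le> (growth ^^ k) b) sequentially"
proof -
  obtain n where n: "C / (b - a) < 8 ^ n" using real_arch_pow[of 8] by auto
  have "C \<le> (b - a) * 8 ^ k" if "n \<le> k" for k
  proof -
    have "(8::real) ^ n \<le> 8 ^ k" using that by (intro power_increasing) auto
    then have "C / (b - a) \<le> 8 ^ k" using n by linarith
    then show ?thesis using assms by (simp add: pos_divide_le_eq mult.commute)
  qed
  then have "eventually (\<lambda>k. C \<le> (b - a) * 8 ^ k) sequentially"
    by (auto simp: eventually_sequentially)
  then show ?thesis
  proof eventually_elim
    case (elim k)
    then show ?case using growth_iter_diff_ge[of a b k] assms by (simp add: mult.commute)
  qed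
qed

lemma growth_iter_surj:
  assumes "0 \<le> y" shows "\<exists>t\<ge>0. (growth ^^ k) t = y"
  using assms
proof (induction k arbitrary: y)
  case (Suc k)
  have "0 \<le> ln (1 + y / 8)" "growth (ln (1 + y / 8)) = y" using Suc.prems by (auto simp: growth_def)
  then show ?case using Suc.IH[of "ln (1 + y / 8)"] by auto
qed auto

section \<open>Levels along orbits and the escape speed\<close>

lemma ht_iter_nonneg: "0 \<le> ht x \<Longrightarrow> 0 \<le> ht ((wrap ^^ k) x)"
  by (induction k) (auto intro: ht_wrap_nonneg)

lemma level_iter_Suc: "0 \<le> ht x \<Longrightarrow> level ((wrap ^^ Suc k) x) = growth (ht ((wrap ^^ k) x))"
  by (simp add: level_wrap ht_iter_nonneg)

lemma ht_le_level: "ht x \<le> level x" by (simp add: level_def)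

text \<open>Since \<open>level\<close> after \<open>wrap\<close> is \<open>growth\<close> of the
  height and \<open>ht \<le> level\<close>, levels never grow faster than \<open>growth\<close>. So
  an orbit that is once below the comparison orbit of \<open>t\<close> stays below it, and the
  existential in \<open>pot\<close> amounts to an eventual statement.\<close>

lemma level_iter_le:
  assumes "0 \<le> ht x" shows "level ((wrap ^^ (j + k)) x) \<le> (growth ^^ j) (level ((wrap ^^ k) x))"
proof (induction j)
  case (Suc j)
  have "level ((wrap ^^ (Suc j + k)) x) = growth (ht ((wrap ^^ (j + k)) x))"
    using level_iter_Suc[OF assms] by simp
  also have "\<dots> \<le> growth (level ((wrap ^^ (j + k)) x))" by (simp add: ht_le_level)
  also have "\<dots> \<le> growth ((growth ^^ j) (level ((wrap ^^ k) x)))" using Suc by simp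
  finally show ?case by simp
qed simp

text \<open>The speed of escape: for a point \<open>x\<close> of a hair other than its endpoint, \<open>ht ((wrap ^^ k) x)\<close> is
  equal to \<open>(growth ^^ k) (pot x)\<close> for all large \<open>k\<close>.\<close>

definition pot :: "real^'n::finite \<Rightarrow> real" where
  "pot x = Inf {t. 0 \<le> t \<and> (\<exists>k. level ((wrap ^^ k) x) \<le> (growth ^^ k) t)}"

lemma pot_le:
  assumes "0 \<le> t" "level ((wrap ^^ k) x) \<le> (growth ^^ k) t" shows "pot x \<le> t"
  unfolding pot_def using assms by (intro cInf_lower bdd_belowI[of _ 0]) auto

lemma pot_set_nonempty:
  assumes "0 \<le> ht x" shows "level x \<in> {t. 0 \<le> t \<and> (\<exists>k. level ((wrap ^^ k) x) \<le> (growth ^^ k) t)}"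
  using level_nonneg[OF assms] by (auto intro: exI[of _ 0])

lemma pot_nonneg: "0 \<le> ht x \<Longrightarrow> 0 \<le> pot x"
  unfolding pot_def using pot_set_nonempty by (intro cInf_greatest) blast+

lemma pot_le_level: "0 \<le> ht x \<Longrightarrow> pot x \<le> level x"
  by (rule pot_le[of _ 0]) (auto simp: level_nonneg)

lemma pot_less_imp:
  assumes "0 \<le> ht x" "pot x < t"
  shows "\<exists>k. \<forall>j\<ge>k. level ((wrap ^^ j) x) < (growth ^^ j) t"
proof -
  have "{t. 0 \<le> t \<and> (\<exists>k. level ((wrap ^^ k) x) \<le> (growth ^^ k) t)} \<noteq> {}"
    using pot_set_nonempty[OF assms(1)] by (rule ex_in_conv[THEN iffD1, OF exI])
  from cInf_lessD[OF this assms(2)[unfolded pot_def]]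
  obtain u k where u: "0 \<le> u" "level ((wrap ^^ k) x) \<le> (growth ^^ k) u" "u < t"
    by auto
  have "level ((wrap ^^ j) x) < (growth ^^ j) t" if "k \<le> j" for j
  proof -
    from le_Suc_ex[OF that] obtain i where j: "j = i + k" by (auto simp: add.commute)
    have "level ((wrap ^^ j) x) \<le> (growth ^^ i) (level ((wrap ^^ k) x))"
      unfolding j by (rule level_iter_le[OF assms(1)])
    also have "\<dots> \<le> (growth ^^ i) ((growth ^^ k) u)" using u by simp
    also have "\<dots> = (growth ^^ j) u" by (simp add: j funpow_add)
    also have "\<dots> < (growth ^^ j) t" using u by simp
    finally show ?thesis .
  qed
  then show ?thesis by blast
qed

lemma le_pot:
  assumes "0 \<le> ht x" "\<And>j. k \<le> j \<Longrightarrow> (growth ^^ j) t \<le> level ((wrap ^^ j) x)" shows "t \<le> pot x"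
proof (rule ccontr)
  assume "\<not> t \<le> pot x"
  then obtain m where "\<forall>j\<ge>m. level ((wrap ^^ j) x) < (growth ^^ j) t"
    using pot_less_imp[OF assms(1), of t] by auto
  then have "level ((wrap ^^ max m k) x) < (growth ^^ max m k) t" by simp
  then show False using assms(2)[of "max m k"] by simp
qed

section \<open>Points with a common itinerary and the order of their potentials\<close>

definition itin :: "(nat \<Rightarrow> 'n::finite \<Rightarrow> int) \<Rightarrow> (real^'n) set" where
  "itin s = {x. \<forall>k. (wrap ^^ k) x \<in> tile (s k)}"

lemma itin_tile: "x \<in> itin s \<Longrightarrow> (wrap ^^ k) x \<in> tile (s k)" by (simp add: itin_def)

lemma itin_ht: "x \<in> itin s \<Longrightarrow> 0 \<le> ht x" using itin_tile[of x s 0] by (simp add: tile_ht)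

lemma itin_cover:
  assumes "0 \<le> ht x" shows "\<exists>s. x \<in> itin s"
proof -
  have "\<forall>k. \<exists>r. (wrap ^^ k) x \<in> tile r" using assms by (simp add: tile_cover ht_iter_nonneg)
  then obtain s where "\<forall>k. (wrap ^^ k) x \<in> tile (s k)" by (rule choice[THEN exE])
  then show ?thesis by (auto simp: itin_def)
qed

lemma lat_itin_diff:
  assumes "x \<in> itin s" "y \<in> itin s"
  shows "lat ((wrap ^^ k) x) \<le> lat ((wrap ^^ k) y) + 2"
  using abs_lat_diff[of "(wrap ^^ k) x" "(wrap ^^ k) y"]
    tile_diff[OF itin_tile[OF assms(1)] itin_tile[OF assms(2)], of k] by linarith

text \<open>Two orbits with the same itinerary stay laterally within distance 2. So once \<open>x\<close> is higher by 1, the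
  gap between the levels exceeds the lateral difference, and the level of \<open>x\<close> is its height from then on.\<close>

lemma higher_imp_pot_less:
  assumes x: "x \<in> itin s" and y: "y \<in> itin s"
    and h: "ht ((wrap ^^ k) y) + 1 \<le> ht ((wrap ^^ k) x)"
  shows "pot y < pot x"
proof -
  define X Y where "X j = (wrap ^^ j) x" and "Y j = (wrap ^^ j) y" for j
  note hx = itin_ht[OF x] note hy = itin_ht[OF y]
  have nn: "0 \<le> ht (X j)" "0 \<le> ht (Y j)" for j
    using hx hy by (auto simp: X_def Y_def intro: ht_iter_nonneg)
  have lev: "level (X (Suc j)) = growth (ht (X j))" "level (Y (Suc j)) = growth (ht (Y j))" for j
    using level_iter_Suc[OF hx] level_iter_Suc[OF hy] by (auto simp: X_def Y_def)
  have step: "ht (Y j) + 1 \<le> ht (X j) \<and> level (X j) = ht (X j)"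
    if "ht (Y i) + 1 \<le> ht (X i)" "j = Suc i" for i j
  proof -
    have "8 * (ht (X i) - ht (Y i)) \<le> level (X j) - level (Y j)"
      using growth_diff_ge[of "ht (Y i)" "ht (X i)"] nn that lev by simp
    then have gap: "level (Y j) + 8 \<le> level (X j)" using that by simp
    have "lat (X j) \<le> lat (Y j) + 2" using lat_itin_diff[OF x y] by (simp add: X_def Y_def)
    then have "lat (X j) - 8 < level (X j)" using gap by (simp add: level_def)
    then have "level (X j) = ht (X j)" by (auto simp: level_def)
    then show ?thesis using gap ht_le_level[of "Y j"] by simp
  qed
  have all: "ht (Y (i + k)) + 1 \<le> ht (X (i + k)) \<and> (growth ^^ i) (ht (X k)) = ht (X (i + k))" for i
  proof (induction i)
    case 0 then show ?case using h by (simp add: X_def Y_def)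
  next
    case (Suc i)
    then show ?case using step[of "i + k" "Suc (i + k)"] lev(1)[of "i + k"] by simp
  qed
  \<comment> \<open>\<open>a\<close> and \<open>b\<close> are the starting values whose pure
    \<open>growth\<close> orbits have the heights of \<open>x\<close> and \<open>y\<close> at time
    \<open>k\<close>.\<close>
  obtain a where a: "0 \<le> a" "(growth ^^ k) a = ht (X k)" using growth_iter_surj nn by blast
  obtain b where b: "0 \<le> b" "(growth ^^ k) b = ht (Y k)" using growth_iter_surj nn by blast
  have "(growth ^^ k) b < (growth ^^ k) a" using a b h by (simp add: X_def Y_def)
  then have "b < a" by simp
  \<comment> \<open>The time \<open>Suc k\<close> matters: the level there is \<open>growth\<close>
    of the height at time \<open>k\<close>, whereas the level at time \<open>k\<close> may exceed
    the height.\<close>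
  moreover have "pot y \<le> b"
    using lev(2)[of k] b by (intro pot_le[of _ "Suc k"]) (auto simp: Y_def)
  moreover have "a \<le> pot x"
  proof (rule le_pot[OF hx])
    fix j assume "k \<le> j"
    then obtain i where j: "j = i + k" by (auto simp: le_iff_add add.commute)
    have "(growth ^^ j) a = (growth ^^ i) (ht (X k))" by (simp add: j funpow_add a)
    also have "\<dots> \<le> level (X j)" using all[of i] ht_le_level[of "X j"] by (simp add: j)
    finally show "(growth ^^ j) a \<le> level ((wrap ^^ j) x)" by (simp add: X_def)
  qed
  ultimately show ?thesis by simp
qed

lemma itin_expanding:
  assumes "\<And>j. j < k \<Longrightarrow> (wrap ^^ j) x \<in> tile (s j) \<and> (wrap ^^ j) y \<in> tile (s j)"
  shows "2 ^ k * infnorm (x - y) \<le> infnorm ((wrap ^^ k) x - (wrap ^^ k) y)"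
  using assms
proof (induction k)
  case (Suc k)
  have "2 ^ Suc k * infnorm (x - y) \<le> 2 * infnorm ((wrap ^^ k) x - (wrap ^^ k) y)"
    using Suc by simp
  also have "\<dots> \<le> infnorm (wrap ((wrap ^^ k) x) - wrap ((wrap ^^ k) y))"
    using Suc.prems[of k] by (intro wrap_expanding2) auto
  finally show ?case by simp
qed simp

text \<open>Distances at least double in each step while lateral differences stay at most 2, so two
  orbits with the same itinerary must separate vertically.\<close>

lemma itin_separated:
  assumes x: "x \<in> itin s" and y: "y \<in> itin s" and "x \<noteq> y"
  obtains k where "2 \<le> \<bar>ht ((wrap ^^ k) x) - ht ((wrap ^^ k) y)\<bar>"
proof -
  have "0 < infnorm (x - y)" using assms by (simp add: infnorm_pos_lt)
  then obtain k where k: "3 / infnorm (x - y) < 2 ^ k" using real_arch_pow[of 2] by auto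
  then have "3 < 2 ^ k * infnorm (x - y)" using \<open>0 < infnorm (x - y)\<close> by (simp add: pos_divide_less_eq)
  also have "\<dots> \<le> infnorm ((wrap ^^ k) x - (wrap ^^ k) y)"
    using itin_tile[OF x] itin_tile[OF y] by (intro itin_expanding) auto
  finally have "\<not> \<bar>ht ((wrap ^^ k) x - (wrap ^^ k) y)\<bar> \<le> 3"
    using infnorm_le_lat_ht[of "(wrap ^^ k) x - (wrap ^^ k) y" 3]
      tile_diff[OF itin_tile[OF x] itin_tile[OF y], of k] by linarith
  then show thesis using that[of k] by (simp add: ht_diff)
qed

text \<open>A converse of \<open>higher_imp_pot_less\<close>: the orbits separate by 2 at some time,
  and the one on top then has the larger potential.\<close>

lemma pot_less_imp_higher:
  assumes "x \<in> itin s" "y \<in> itin s" "pot x < pot y"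
  obtains k where "ht ((wrap ^^ k) x) + 2 \<le> ht ((wrap ^^ k) y)"
proof -
  obtain k where k: "2 \<le> \<bar>ht ((wrap ^^ k) x) - ht ((wrap ^^ k) y)\<bar>"
    using itin_separated[OF assms(1,2)] assms(3) by (metis less_irrefl)
  then show thesis using higher_imp_pot_less[OF assms(1,2), of k] assms(3) that[of k] by (auto simp: abs_if split: if_splits)
qed

lemma pot_inj: "inj_on pot (itin s)"
proof (rule inj_onI, rule ccontr)
  fix x y assume x: "x \<in> itin s" and y: "y \<in> itin s" and e: "pot x = pot y" and ne: "x \<noteq> y"
  obtain k where "2 \<le> \<bar>ht ((wrap ^^ k) x) - ht ((wrap ^^ k) y)\<bar>"
    using itin_separated[OF x y ne] by blast
  then show False
    using higher_imp_pot_less[OF x y, of k] higher_imp_pot_less[OF y x, of k] e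
    by (auto simp: abs_if split: if_splits)
qed

text \<open>Describes a sublevel set of \<open>pot\<close> by closed conditions on orbits, which
  gives its compactness without continuity of \<open>pot\<close>. The slack 1 is what
  \<open>higher_imp_pot_less\<close> excludes and is smaller than the gap 2 of
  \<open>pot_less_imp_higher\<close>.\<close>

lemma sublevel_eq:
  assumes w: "w \<in> itin s"
  shows "{x \<in> itin s. pot x \<le> pot w} = {x \<in> itin s. \<forall>k. ht ((wrap ^^ k) x) \<le> ht ((wrap ^^ k) w) + 1}"
proof (intro Collect_cong conj_cong refl iffI allI)
  fix x k assume x: "x \<in> itin s" and p: "pot x \<le> pot w"
  show "ht ((wrap ^^ k) x) \<le> ht ((wrap ^^ k) w) + 1"
    using higher_imp_pot_less[OF x w, of k] p by linarith
next
  fix x assume x: "x \<in> itin s" and "\<forall>k. ht ((wrap ^^ k) x) \<le> ht ((wrap ^^ k) w) + 1"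
  then show "pot x \<le> pot w" using pot_less_imp_higher[OF w x] by (smt (verit))
qed

lemma continuous_on_iter: "continuous_on {x. 0 \<le> ht x} (wrap ^^ k)"
proof (induction k)
  case (Suc k)
  show ?case unfolding funpow.simps o_def
    by (rule continuous_on_compose2[OF continuous_on_wrap Suc]) (auto simp: ht_iter_nonneg)
qed (simp add: continuous_on_id id_def)

lemma closed_upper: "closed {x. 0 \<le> ht x}"
  by (intro closed_Collect_le continuous_intros)

lemma closed_iter_vimage:
  assumes "closed S" shows "closed {x. 0 \<le> ht x \<and> (wrap ^^ k) x \<in> S}"
proof -
  have "closed ({x. 0 \<le> ht x} \<inter> (wrap ^^ k) -` S)"
    using continuous_on_iter closed_upper assms by (rule continuous_closed_preimage)
  moreover have "{x. 0 \<le> ht x} \<inter> (wrap ^^ k) -` S = {x. 0 \<le> ht x \<and> (wrap ^^ k) x \<in> S}" by auto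
  ultimately show ?thesis by simp
qed

lemma closed_itin: "closed (itin s)"
proof -
  have "itin s = (\<Inter>k. {x. 0 \<le> ht x \<and> (wrap ^^ k) x \<in> tile (s k)})"
    using itin_ht by (auto simp: itin_def)
  also have "closed \<dots>" by (intro closed_INT ballI closed_iter_vimage closed_tile)
  finally show ?thesis .
qed

lemma bounded_infnormI:
  fixes S :: "(real^'n::finite) set"
  assumes "\<And>x. x \<in> S \<Longrightarrow> infnorm (x - a) \<le> B" shows "bounded S"
proof -
  have "norm (x - a) \<le> sqrt DIM(real^'n) * B" if "x \<in> S" for x
    using order_trans[OF norm_le_infnorm[of "x - a"] mult_left_mono[OF assms[OF that]]] by simp
  then have "S \<subseteq> cball a (sqrt DIM(real^'n) * B)" by (auto simp: dist_norm norm_minus_commute)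
  then show ?thesis using bounded_cball bounded_subset by blast
qed

lemma compact_sublevel:
  assumes w: "w \<in> itin s" shows "compact {x \<in> itin s. pot x \<le> pot w}"
proof -
  have "{x \<in> itin s. pot x \<le> pot w}
      = itin s \<inter> (\<Inter>k. {x. 0 \<le> ht x \<and> (wrap ^^ k) x \<in> {y. ht y \<le> ht ((wrap ^^ k) w) + 1}})"
    unfolding sublevel_eq[OF w] using itin_ht by auto
  moreover have "closed \<dots>"
    by (intro closed_Int closed_INT ballI closed_iter_vimage closed_itin closed_Collect_le continuous_intros)
  moreover have "bounded {x \<in> itin s. pot x \<le> pot w}"
  proof (rule bounded_infnormI)
    fix x assume x: "x \<in> {x \<in> itin s. pot x \<le> pot w}"
    then have "ht x \<le> ht w + 1" "0 \<le> ht x" using itin_ht unfolding sublevel_eq[OF w] by (auto dest: spec[of _ 0])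
    moreover have "lat (x - w) \<le> 2" using tile_diff[of x "s 0" w] itin_tile[of _ s 0] x w by simp
    ultimately show "infnorm (x - w) \<le> max 2 (ht w + 1)"
      using itin_ht[OF w] by (intro infnorm_le_lat_ht) (auto simp: ht_diff)
  qed
  ultimately show ?thesis by (simp add: compact_eq_bounded_closed)
qed

section \<open>Inverse branches and points of prescribed potential\<close>

lemma pull_back:
  assumes "0 \<le> ht y"
  shows "\<exists>x. 0 \<le> ht x \<and> (wrap ^^ k) x = y \<and> (\<forall>j<k. (wrap ^^ j) x \<in> tile (s j))"
  using assms
proof (induction k arbitrary: y)
  case (Suc k)
  obtain z where z: "z \<in> tile (s k)" "wrap z = y" using wrap_surj[OF Suc.prems] by blast
  obtain x where "0 \<le> ht x" "(wrap ^^ k) x = z" "\<forall>j<k. (wrap ^^ j) x \<in> tile (s j)"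
    using Suc.IH[OF tile_ht[OF z(1)]] by blast
  then show ?case using z by (intro exI[of _ x]) (auto simp: less_Suc_eq)
qed auto

text \<open>The point of potential \<open>t\<close> is obtained as a limit of points that reach the height
  \<open>(growth ^^ k) t\<close> after \<open>k\<close> steps.\<close>

lemma exists_larger_pot:
  assumes z: "z \<in> itin s" and t: "pot z < t"
  shows "\<exists>x\<in>itin s. pot x = t"
proof -
  note hz = itin_ht[OF z]
  obtain u where u: "pot z < u" "u < t" using t dense by blast
  have u0: "0 \<le> u" "0 \<le> t" using pot_nonneg[OF hz] u by auto
  obtain k1 where k1: "\<forall>k\<ge>k1. level ((wrap ^^ k) z) < (growth ^^ k) u"
    using pot_less_imp[OF hz u(1)] by blast
  \<comment> \<open>The 10 is the 8 in the definition of \<open>level\<close> plus the lateral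
    difference 2 within a half-beam.\<close>
  obtain k2 where k2: "\<forall>k\<ge>k2. (growth ^^ k) u + 10 \<le> (growth ^^ k) t"
    using eventually_growth_gap[OF u0(1) u(2)] unfolding eventually_sequentially by blast
  define K where "K = max k1 k2"
  have lz: "lat ((wrap ^^ k) z) + 2 \<le> (growth ^^ k) t" if "K \<le> k" for k
  proof -
    have "lat ((wrap ^^ k) z) - 8 \<le> level ((wrap ^^ k) z)" by (simp add: level_def)
    also have "\<dots> < (growth ^^ k) u" using k1 that by (simp add: K_def)
    finally show ?thesis using k2 that by (smt (verit) K_def max.bounded_iff)
  qed
  have g0: "0 \<le> (growth ^^ k) t" for k using growth_iter_nonneg u0 by blast
  \<comment> \<open>The target at time \<open>k\<close> has the lateral position of the orbit of
    \<open>z\<close>, hence lies in the right half-beam, but the height that potential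
    \<open>t\<close> calls for.\<close>
  define y where "y k = (\<chi> i. if i = vert then (growth ^^ k) t else (wrap ^^ k) z $ i)" for k
  have hy: "ht (y k) = (growth ^^ k) t" for k by (simp add: y_def ht_def)
  have ytile: "y k \<in> tile (s k)" for k
    using itin_tile[OF z, of k] g0[of k] by (simp add: tile_def hy) (simp add: y_def)
  have "\<exists>x. 0 \<le> ht x \<and> (wrap ^^ k) x = y k \<and> (\<forall>j<k. (wrap ^^ j) x \<in> tile (s j))" for k
    by (rule pull_back) (simp add: hy g0)
  then obtain x where x: "\<And>k. 0 \<le> ht (x k)" "\<And>k. (wrap ^^ k) (x k) = y k"
    "\<And>k j. j < k \<Longrightarrow> (wrap ^^ j) (x k) \<in> tile (s j)" by metis
  have xt: "(wrap ^^ j) (x k) \<in> tile (s j)" if "j \<le> k" for j k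
    using x(2,3) ytile that by (metis le_neq_implies_less)
  \<comment> \<open>Induction backwards from time \<open>k\<close> down to \<open>K\<close>: by
    \<open>lz\<close> the lateral term does not exceed the height, so the level is the height, and
    injectivity of \<open>growth\<close> determines the height one step earlier.\<close>
  have hx: "ht ((wrap ^^ (k - i)) (x k)) = (growth ^^ (k - i)) t" if "K + i \<le> k" for i k
    using that
  proof (induction i)
    case 0 then show ?case by (simp add: x hy)
  next
    case (Suc i)
    define j where "j = k - Suc i"
    have j: "k - i = Suc j" "K \<le> Suc j" using Suc.prems by (auto simp: j_def)
    have "Suc j \<le> k" using Suc.prems by (simp add: j_def)
    then have "lat ((wrap ^^ Suc j) (x k)) \<le> lat ((wrap ^^ Suc j) z) + 2"
      using tile_diff[OF xt[of "Suc j" k] itin_tile[OF z, of "Suc j"]]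
        abs_lat_diff[of "(wrap ^^ Suc j) (x k)" "(wrap ^^ Suc j) z"] by linarith
    then have "level ((wrap ^^ Suc j) (x k)) = (growth ^^ Suc j) t"
      using lz[OF j(2)] Suc j by (simp add: level_def)
    then have "growth (ht ((wrap ^^ j) (x k))) = growth ((growth ^^ j) t)"
      using level_iter_Suc[OF x(1)] by simp
    then have "ht ((wrap ^^ j) (x k)) = (growth ^^ j) t" by (simp add: growth_def)
    then show ?case by (simp add: j_def)
  qed
  have hx': "ht ((wrap ^^ j) (x k)) = (growth ^^ j) t" if "K \<le> j" "j \<le> k" for j k
    using hx[of "k - j" k] that by simp
  define B where "B = max 2 \<bar>(growth ^^ K) t - ht ((wrap ^^ K) z)\<bar>"
  \<comment> \<open>Expansion over the first \<open>K\<close> steps carries the bound at time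
    \<open>K\<close>, where lateral difference and height are both controlled, back to the starting
    points.\<close>
  have near: "infnorm (x k - z) \<le> B" if "K \<le> k" for k
  proof -
    have "infnorm (x k - z) \<le> 2 ^ K * infnorm (x k - z)"
      using mult_right_mono[OF one_le_power[of "2 :: real" K] infnorm_pos_le[of "x k - z"]] by simp
    also have "\<dots> \<le> infnorm ((wrap ^^ K) (x k) - (wrap ^^ K) z)"
      using xt that itin_tile[OF z] by (intro itin_expanding[of _ _ s]) auto
    also have "\<dots> \<le> B"
      using tile_diff[OF xt[of K k] itin_tile[OF z, of K]] that
      by (intro infnorm_le_lat_ht) (auto simp: B_def ht_diff hx')
    finally show ?thesis .
  qed
  have "bounded (range (\<lambda>k. x (k + K)))"
    by (rule bounded_infnormI[of _ z B]) (auto intro: near)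
  then obtain a \<phi> where \<phi>: "strict_mono \<phi>" and lim: "((\<lambda>k. x (k + K)) \<circ> \<phi>) \<longlonglongrightarrow> a"
    using bounded_imp_convergent_subsequence by blast
  have ha: "0 \<le> ht a"
    using closed_sequentially[OF closed_upper _ lim] x(1) by (simp add: o_def)
  have limj: "(\<lambda>n. (wrap ^^ j) (x (\<phi> n + K))) \<longlonglongrightarrow> (wrap ^^ j) a" for j
    using continuous_on_tendsto_compose[OF continuous_on_iter lim, of j] ha x(1) by (simp add: o_def)
  have big: "eventually (\<lambda>n. j \<le> \<phi> n + K) sequentially" for j
    using \<phi> by (intro eventually_sequentiallyI[of j]) (meson le_trans seq_suble trans_le_add1)
  have at: "(wrap ^^ j) a \<in> tile (s j)" for j
    by (rule Lim_in_closed_set[OF closed_tile _ _ limj])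
      (use big[of j] in \<open>auto elim!: eventually_mono intro: xt\<close>)
  then have a: "a \<in> itin s" by (simp add: itin_def)
  have hta: "ht ((wrap ^^ j) a) = (growth ^^ j) t" if "K \<le> j" for j
  proof (rule LIMSEQ_unique)
    show "(\<lambda>n. ht ((wrap ^^ j) (x (\<phi> n + K)))) \<longlonglongrightarrow> ht ((wrap ^^ j) a)"
      unfolding ht_def by (intro tendsto_intros limj)
    show "(\<lambda>n. ht ((wrap ^^ j) (x (\<phi> n + K)))) \<longlonglongrightarrow> (growth ^^ j) t"
      by (rule tendsto_eventually) (use big[of j] that in \<open>auto elim!: eventually_mono intro: hx'\<close>)
  qed
  have leva: "level ((wrap ^^ j) a) = (growth ^^ j) t" if "K \<le> j" for j
    using hta[OF that] lz[OF that] lat_itin_diff[OF a z, of j] by (simp add: level_def)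
  have "pot a = t"
    using pot_le[of t K a] le_pot[OF ha, of K t] leva u0 by (simp add: antisym)
  then show ?thesis using a by blast
qed

text \<open>Each half of the proof needs only one time \<open>k\<close>. From above, the level of
  the orbit is below a comparison value at time \<open>k\<close>, and this is an open condition.
  From below, a point \<open>w\<close> of the same hair with intermediate potential is overtaken by
  more than 1 at time \<open>k\<close>.\<close>

lemma continuous_on_pot: "continuous_on (itin s) pot"
proof (rule continuous_on_sequentially[THEN iffD2], intro allI ballI impI, elim conjE)
  fix x :: "nat \<Rightarrow> real^'a" and a
  assume a: "a \<in> itin s" and xs: "\<forall>n. x n \<in> itin s" and lim: "x \<longlonglongrightarrow> a"
  note ha = itin_ht[OF a]
  have limk: "(\<lambda>n. (wrap ^^ k) (x n)) \<longlonglongrightarrow> (wrap ^^ k) a" for k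
    by (rule continuous_on_tendsto_compose[OF continuous_on_iter lim]) (use ha xs itin_ht in \<open>auto intro!: always_eventually\<close>)
  show "(pot \<circ> x) \<longlonglongrightarrow> pot a"
    unfolding o_def
  proof (rule order_tendstoI)
    fix t assume "pot a < t"
    then obtain u where u: "pot a < u" "u < t" using dense by blast
    then obtain k where k: "level ((wrap ^^ k) a) < (growth ^^ k) u" using pot_less_imp[OF ha, of u] by blast
    have "(\<lambda>n. level ((wrap ^^ k) (x n))) \<longlonglongrightarrow> level ((wrap ^^ k) a)"
      by (rule continuous_on_tendsto_compose[OF continuous_on_level[OF continuous_on_id[of UNIV]] limk]) auto
    then have "eventually (\<lambda>n. level ((wrap ^^ k) (x n)) < (growth ^^ k) u) sequentially"
      using k by (rule order_tendstoD)
    then show "eventually (\<lambda>n. pot (x n) < t) sequentially"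
    proof eventually_elim
      case (elim n)
      have "pot (x n) \<le> u" using elim pot_nonneg[OF ha] u by (intro pot_le[of _ k]) auto
      then show ?case using u by simp
    qed
  next
    fix t assume t: "t < pot a"
    show "eventually (\<lambda>n. t < pot (x n)) sequentially"
    proof (cases "\<exists>z\<in>itin s. pot z \<le> t")
      case False
      then show ?thesis using xs by (auto simp: not_le)
    next
      case True
      then obtain z where z: "z \<in> itin s" "pot z \<le> t" by blast
      then obtain w where w: "w \<in> itin s" "pot w = (t + pot a) / 2"
        using exists_larger_pot[OF z(1), of "(t + pot a) / 2"] t by auto
      obtain k where k: "ht ((wrap ^^ k) w) + 2 \<le> ht ((wrap ^^ k) a)"
        using pot_less_imp_higher[OF w(1) a] w t by auto
      have "(\<lambda>n. ht ((wrap ^^ k) (x n))) \<longlonglongrightarrow> ht ((wrap ^^ k) a)"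
        unfolding ht_def by (intro tendsto_intros limk)
      then have "eventually (\<lambda>n. ht ((wrap ^^ k) w) + 1 < ht ((wrap ^^ k) (x n))) sequentially"
        by (rule order_tendstoD) (use k in simp)
      then show ?thesis
      proof eventually_elim
        case (elim n)
        have "pot w < pot (x n)"
          using higher_imp_pot_less[OF xs[rule_format] w(1), of k n] elim by simp
        then show ?case using w t by simp
      qed
    qed
  qed
qed

text \<open>The endpoint minimises \<open>pot\<close> over a compact sublevel set. By
  \<open>exists_larger_pot\<close> the values of \<open>pot\<close> fill a closed half-line, and the
  inverse is continuous because it is so on the images of compact sublevel sets. It tends to
  infinity since \<open>pot \<le> level \<le> norm\<close>.\<close>

lemma itin_hair:
  assumes "itin s \<noteq> {}"
  obtains p where "p \<in> itin s" "\<And>x. x \<in> itin s \<Longrightarrow> pot p \<le> pot x" "hair_with_endpoint (itin s) p"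
proof -
  obtain w where w: "w \<in> itin s" using assms by blast
  obtain p where p: "p \<in> itin s" "pot p \<le> pot w"
    and "\<And>x. x \<in> itin s \<Longrightarrow> pot x \<le> pot w \<Longrightarrow> pot p \<le> pot x"
    using continuous_attains_inf[OF compact_sublevel[OF w] _ continuous_on_subset[OF continuous_on_pot, of _ s]] w
    by (auto simp: subset_iff)
  then have min: "pot p \<le> pot x" if "x \<in> itin s" for x using that by (meson linear order_trans)
  define g where "g t = the_inv_into (itin s) pot (pot p + t)" for t
  have im: "pot ` itin s = {pot p..}"
  proof (intro equalityI subsetI)
    fix t assume "t \<in> {pot p..}"
    then show "t \<in> pot ` itin s" using exists_larger_pot[OF p(1), of t] p(1) by (cases "t = pot p") auto
  qed (use min in auto)
  have gi: "g t \<in> itin s" "pot (g t) = pot p + t" if "0 \<le> t" for t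
    using the_inv_into_into[OF pot_inj, of "pot p + t" s "itin s"] f_the_inv_into_f[OF pot_inj, of "pot p + t" s] im that
    by (auto simp: g_def)
  have gp: "g (pot x - pot p) = x" if "x \<in> itin s" for x
    using the_inv_into_f_f[OF pot_inj that] by (simp add: g_def)
  have cont: "continuous_on {pot p..pot p + b} (the_inv_into (itin s) pot)" if b: "0 \<le> b" for b
  proof -
    let ?K = "{x \<in> itin s. pot x \<le> pot (g b)}"
    have "continuous_on (pot ` ?K) (the_inv_into (itin s) pot)"
    proof (rule continuous_on_inv)
      show "continuous_on ?K pot" by (rule continuous_on_subset[OF continuous_on_pot]) auto
      show "compact ?K" by (rule compact_sublevel[OF gi(1)[OF b]])
      show "\<forall>x\<in>?K. the_inv_into (itin s) pot (pot x) = x" by (simp add: the_inv_into_f_f[OF pot_inj])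
    qed
    moreover have "{pot p..pot p + b} \<subseteq> pot ` ?K"
    proof
      fix t assume t: "t \<in> {pot p..pot p + b}"
      then obtain x where "x \<in> itin s" "t = pot x" using im by (metis atLeastAtMost_iff atLeast_iff imageE)
      then show "t \<in> pot ` ?K" using t gi(2)[OF b] by auto
    qed
    ultimately show ?thesis by (rule continuous_on_subset)
  qed
  have contg: "continuous_on {0..b} g" if "0 \<le> b" for b
    unfolding g_def by (rule continuous_on_compose2[OF cont[OF that]]) (auto intro!: continuous_intros)
  have "hair_param g"
    unfolding hair_param_def
  proof (intro conjI)
    show "continuous_on {0..} g"
      unfolding continuous_on_eq_continuous_within
    proof
      fix t :: real assume t: "t \<in> {0..}"
      have "continuous (at t within {0..t + 1}) g"
        using contg[of "t + 1"] t by (auto simp: continuous_on_eq_continuous_within)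
      moreover have "at t within {0..t + 1} = at t within {0..}"
        by (rule at_within_nhd[of _ "{..<t + 1}"]) (use t in auto)
      ultimately show "continuous (at t within {0..}) g" by simp
    qed
    show "inj_on g {0..}"
      by (rule inj_onI) (metis gi(2) atLeast_iff add_left_cancel)
    have "filterlim (\<lambda>t. pot p + t) at_top at_top"
      by (rule filterlim_tendsto_add_at_top[OF tendsto_const filterlim_ident])
    then show "filterlim (\<lambda>t. norm (g t)) at_top at_top"
    proof (rule filterlim_at_top_mono)
      show "eventually (\<lambda>t. pot p + t \<le> norm (g t)) at_top"
        using eventually_ge_at_top[of 0]
      proof eventually_elim
        case (elim t)
        have "pot p + t \<le> level (g t)" using gi[OF elim] pot_le_level[OF itin_ht] by fastforce
        also have "\<dots> \<le> infnorm (g t)"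
          using lat_le_infnorm[of "g t"] abs_ht_le_infnorm[of "g t"] by (simp add: level_def)
        also have "\<dots> \<le> norm (g t)" by (rule infnorm_le_norm)
        finally show ?case .
      qed
    qed
  qed
  moreover have "g ` {0..} = itin s"
    using gi(1) gp min by (auto simp: image_iff) (metis atLeast_iff diff_ge_0_iff_ge)
  moreover have "g 0 = p" using gp[OF p(1)] by simp
  ultimately have "hair_with_endpoint (itin s) p" unfolding hair_with_endpoint_def by blast
  then show thesis using that p(1) min by blast
qed

text \<open>Height 0 at time \<open>k\<close> means level 0 at time \<open>Suc k\<close>, and 0 is a
  fixed point of \<open>growth\<close>.\<close>

lemma pot_zero_if_ht_zero:
  assumes "0 \<le> ht x" "ht ((wrap ^^ k) x) = 0" shows "pot x = 0"
proof -
  have "(growth ^^ Suc k) 0 = 0" by (induction k) (auto simp: growth_def)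
  then have "pot x \<le> 0"
    using level_iter_Suc[OF assms(1), of k] assms(2) by (intro pot_le[of _ "Suc k"]) (auto simp: growth_def)
  then show ?thesis using pot_nonneg[OF assms(1)] by simp
qed

lemma pot_zero_if_common:
  assumes "x \<in> itin s" "x \<in> itin s'" "itin s \<noteq> itin s'" shows "pot x = 0"
proof -
  obtain k where "tile (s k) \<noteq> tile (s' k)" using assms(3) by (auto simp: itin_def)
  then have "ht (wrap ((wrap ^^ k) x)) = 0"
    using wrap_wall itin_tile[OF assms(1)] itin_tile[OF assms(2)] by blast
  then show ?thesis using pot_zero_if_ht_zero[OF itin_ht[OF assms(1)], of "Suc k"] by simp
qed

subsection \<open>Hausdorff content\<close>

text \<open>Unlike the Hausdorff premeasures, this is at most \<open>diameter A powr s\<close> for every bounded \<open>A\<close>, yet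
  for positive \<open>s\<close> it has the same null sets as the Hausdorff measure.\<close>

definition hcontent :: "real \<Rightarrow> 'a::metric_space set \<Rightarrow> ennreal" where
  "hcontent s A = (INF C \<in> {C :: nat \<Rightarrow> 'a set. A \<subseteq> (\<Union>i. C i) \<and> (\<forall>i. bounded (C i))}.
     (\<Sum>i. ennreal (diameter (C i) powr s)))"

lemma hcontent_le:
  assumes "A \<subseteq> (\<Union>i. C i)" "\<And>i. bounded (C i)"
  shows "hcontent s A \<le> (\<Sum>i. ennreal (diameter (C i) powr s))"
  unfolding hcontent_def using assms by (intro INF_lower) auto

lemma hcontent_less:
  assumes "hcontent s A < b"
  obtains C where "A \<subseteq> (\<Union>i. C i)" "\<And>i::nat. bounded (C i)" "(\<Sum>i. ennreal (diameter (C i) powr s)) < b"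
  using assms unfolding hcontent_def INF_less_iff by auto

lemma hcontent_mono: "A \<subseteq> B \<Longrightarrow> hcontent s A \<le> hcontent s B"
  unfolding hcontent_def by (intro INF_superset_mono) auto

lemma hcontent_null_subset: "A \<subseteq> B \<Longrightarrow> hcontent s B = 0 \<Longrightarrow> hcontent s A = 0"
  using hcontent_mono[of A B s] by simp

lemma hcontent_le_diameter:
  assumes "bounded A" shows "hcontent s A \<le> ennreal (diameter A powr s)"
proof -
  \<comment> \<open>Padding with empty sets is free even for \<open>s = 0\<close>, as
    \<open>diameter {} = 0\<close> and \<open>0 powr 0 = 0\<close>.\<close>
  define C where "C i = (if i = 0 then A else {})" for i :: nat
  have "hcontent s A \<le> (\<Sum>i. ennreal (diameter (C i) powr s))"
    by (rule hcontent_le) (use assms in \<open>auto simp: C_def\<close>)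
  also have "\<dots> = (\<Sum>i\<in>{0}. ennreal (diameter (C i) powr s))"
    by (rule suminf_finite) (auto simp: C_def)
  finally show ?thesis by (simp add: C_def)
qed

lemma hcontent_empty [simp]: "hcontent s {} = 0"
  using hcontent_le_diameter[of "{}" s] by simp

lemma ennreal_le_suminf: "f i \<le> (\<Sum>i. f i :: ennreal)"
  using sum_le_suminf[of f "{i}"] by simp

lemma ennreal_less_add:
  fixes a b :: ennreal
  shows "a < top \<Longrightarrow> 0 < b \<Longrightarrow> a < a + b"
  using ennreal_add_left_cancel_less[of a 0 b] by simp

lemma hcontent_UN: "hcontent s (\<Union>i::nat. A i) \<le> (\<Sum>i. hcontent s (A i))"
proof (rule ennreal_le_epsilon)
  fix e :: real assume fin: "(\<Sum>i. hcontent s (A i)) < top" and e: "0 < e"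
  have "hcontent s (A i) < top" for i
  proof -
    have "hcontent s (A i) \<le> (\<Sum>i. hcontent s (A i))" by (rule ennreal_le_suminf)
    then show ?thesis using fin by (rule le_less_trans)
  qed
  moreover have "0 < ennreal (e * (1 / 2) ^ Suc i)" for i using e by simp
  ultimately have lt: "hcontent s (A i) < hcontent s (A i) + ennreal (e * (1 / 2) ^ Suc i)" for i
    by (rule ennreal_less_add)
  have "\<exists>C. A i \<subseteq> (\<Union>j. C j) \<and> (\<forall>j::nat. bounded (C j)) \<and>
      (\<Sum>j. ennreal (diameter (C j) powr s)) < hcontent s (A i) + ennreal (e * (1 / 2) ^ Suc i)" for i
    by (rule hcontent_less[OF lt[of i]]) blast
  then have "\<exists>C. \<forall>i. A i \<subseteq> (\<Union>j. C i j) \<and> (\<forall>j::nat. bounded (C i j)) \<and>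
      (\<Sum>j. ennreal (diameter (C i j) powr s)) < hcontent s (A i) + ennreal (e * (1 / 2) ^ Suc i)"
    by (intro choice allI)
  then obtain C where C: "\<And>i. A i \<subseteq> (\<Union>j. C i j)" "\<And>i j::nat. bounded (C i j)"
    "\<And>i. (\<Sum>j. ennreal (diameter (C i j) powr s)) < hcontent s (A i) + ennreal (e * (1 / 2) ^ Suc i)"
    by blast
  define D where "D k = C (fst (prod_decode k)) (snd (prod_decode k))" for k
  have "hcontent s (\<Union>i. A i) \<le> (\<Sum>k. ennreal (diameter (D k) powr s))"
  proof (rule hcontent_le)
    show "(\<Union>i. A i) \<subseteq> (\<Union>k. D k)"
    proof
      fix x assume "x \<in> (\<Union>i. A i)"
      then obtain i j where "x \<in> C i j" using C(1) by blast
      then have "x \<in> D (prod_encode (i, j))" by (simp add: D_def)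
      then show "x \<in> (\<Union>k. D k)" by blast
    qed
    show "bounded (D k)" for k by (simp add: D_def C(2))
  qed
  also have "\<dots> = (\<Sum>i. \<Sum>j. ennreal (diameter (C i j) powr s))"
    unfolding D_def
    by (rule suminf_ennreal_2dimen[of _ "\<lambda>p. ennreal (diameter (C (fst p) (snd p)) powr s)"]) simp
  also have "\<dots> \<le> (\<Sum>i. hcontent s (A i) + ennreal (e * (1 / 2) ^ Suc i))"
    by (intro suminf_le less_imp_le C(3)) auto
  also have "\<dots> = (\<Sum>i. hcontent s (A i)) + (\<Sum>i. ennreal (e * (1 / 2) ^ Suc i))"
    by (rule suminf_add[symmetric]) auto
  also have "(\<Sum>i. ennreal (e * (1 / 2) ^ Suc i)) = ennreal e"
    using e sums_mult[OF power_half_series, of e] by (intro suminf_ennreal_eq) auto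
  finally show "hcontent s (\<Union>i. A i) \<le> (\<Sum>i. hcontent s (A i)) + ennreal e" .
qed

lemma hcontent_Un: "hcontent s (A \<union> B) \<le> hcontent s A + hcontent s B"
  using hcontent_UN[of s "binaryset A B"] suminf_binaryset_eq[of "hcontent s" A B]
  by (simp only: UN_binaryset_eq hcontent_empty simp_thms)

lemma hcontent_UN_finite:
  assumes "finite I" shows "hcontent s (\<Union>i\<in>I. A i) \<le> (\<Sum>i\<in>I. hcontent s (A i))"
  using assms
proof induction
  case (insert i I)
  then show ?case
    using hcontent_Un[of s "A i" "\<Union>i\<in>I. A i"] by (simp add: add_left_mono order_trans)
qed simp

lemma hcontent_null_UN:
  assumes "countable I" "\<And>i. i \<in> I \<Longrightarrow> hcontent s (A i) = 0" shows "hcontent s (\<Union>i\<in>I. A i) = 0"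
proof (cases "I = {}")
  case False
  have "(\<Union>i\<in>I. A i) = (\<Union>n. A (from_nat_into I n))"
    using range_from_nat_into[OF False assms(1)] by (metis image_image)
  moreover have "(\<Sum>n. hcontent s (A (from_nat_into I n))) = 0"
    using assms(2) from_nat_into[OF False] by simp
  ultimately show ?thesis using hcontent_UN[of s "\<lambda>n. A (from_nat_into I n)"] by simp
qed simp

text \<open>Covers of \<open>A\<close> are pulled back to \<open>S\<close>, which multiplies
  diameters by at most \<open>K\<close>. Stating this for the expanding map avoids naming its
  inverse branches.\<close>

lemma hcontent_preimage_le:
  fixes f :: "'a::real_normed_vector \<Rightarrow> 'b::metric_space"
  assumes K: "0 < K" and s: "0 \<le> s"
    and f: "\<And>x y. x \<in> S \<Longrightarrow> y \<in> S \<Longrightarrow> norm (x - y) \<le> K * dist (f x) (f y)"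
    and A: "\<And>x. x \<in> S \<Longrightarrow> f x \<in> A"
  shows "hcontent s S \<le> ennreal (K powr s) * hcontent s A"
proof (rule ennreal_le_epsilon)
  fix e :: real assume fin: "ennreal (K powr s) * hcontent s A < top" and e: "0 < e"
  have Ks: "0 < K powr s" using K by simp
  have "hcontent s A < top" using fin Ks by (auto simp: ennreal_mult_less_top)
  moreover have "0 < ennreal (e / K powr s)" using e Ks by simp
  ultimately have "hcontent s A < hcontent s A + ennreal (e / K powr s)"
    by (rule ennreal_less_add)
  then obtain C where C: "A \<subseteq> (\<Union>i. C i)" "\<And>i::nat. bounded (C i)"
    "(\<Sum>i. ennreal (diameter (C i) powr s)) < hcontent s A + ennreal (e / K powr s)"
    by (rule hcontent_less) blast
  define D where "D i = S \<inter> f -` C i" for i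
  have dist: "norm (x - y) \<le> K * diameter (C i)" if "x \<in> D i" "y \<in> D i" for x y i
  proof -
    have "norm (x - y) \<le> K * dist (f x) (f y)" using f that by (simp add: D_def)
    also have "\<dots> \<le> K * diameter (C i)"
      using diameter_bounded_bound[OF C(2)] that K by (intro mult_left_mono) (auto simp: D_def)
    finally show ?thesis .
  qed
  have bD: "bounded (D i)" for i
    unfolding bounded_two_points by (rule exI[of _ "K * diameter (C i)"]) (use dist in \<open>auto simp: dist_norm\<close>)
  have dD: "diameter (D i) \<le> K * diameter (C i)" for i
    using dist K diameter_ge_0[OF C(2), of i] by (intro diameter_le) auto
  have "hcontent s S \<le> (\<Sum>i. ennreal (diameter (D i) powr s))"
  proof (rule hcontent_le[OF _ bD])
    show "S \<subseteq> (\<Union>i. D i)"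
    proof
      fix x assume x: "x \<in> S"
      then obtain i where "f x \<in> C i" using subsetD[OF C(1) A[OF x]] by blast
      then show "x \<in> (\<Union>i. D i)" using x by (auto simp: D_def)
    qed
  qed
  also have "\<dots> \<le> (\<Sum>i. ennreal (K powr s) * ennreal (diameter (C i) powr s))"
  proof (intro suminf_le)
    fix i
    have "diameter (D i) powr s \<le> (K * diameter (C i)) powr s"
      using dD diameter_ge_0[OF bD] s by (intro powr_mono2) auto
    then have "diameter (D i) powr s \<le> K powr s * diameter (C i) powr s"
      using K diameter_ge_0[OF C(2), of i] by (simp add: powr_mult)
    then show "ennreal (diameter (D i) powr s) \<le> ennreal (K powr s) * ennreal (diameter (C i) powr s)"
      by (simp add: ennreal_leI flip: ennreal_mult)
  qed auto
  also have "\<dots> = ennreal (K powr s) * (\<Sum>i. ennreal (diameter (C i) powr s))" by simp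
  also have "\<dots> \<le> ennreal (K powr s) * (hcontent s A + ennreal (e / K powr s))"
    using C(3) by (intro mult_left_mono) auto
  also have "\<dots> = ennreal (K powr s) * hcontent s A + ennreal e"
    using K e by (simp add: distrib_left flip: ennreal_mult)
  finally show "hcontent s S \<le> ennreal (K powr s) * hcontent s A + ennreal e" .
qed

lemma hcontent_null_preimage:
  fixes f :: "'a::real_normed_vector \<Rightarrow> 'b::metric_space"
  assumes "0 < K" "0 \<le> s" "\<And>x y. x \<in> S \<Longrightarrow> y \<in> S \<Longrightarrow> norm (x - y) \<le> K * dist (f x) (f y)"
    and "\<And>x. x \<in> S \<Longrightarrow> f x \<in> A" "hcontent s A = 0"
  shows "hcontent s S = 0"
  using hcontent_preimage_le[OF assms(1-4)] assms(5) by simp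

text \<open>If the sum for a cover is below \<open>\<delta> powr s\<close>, then so is each term,
  and every diameter is at most \<open>\<delta>\<close>. Covers of small total weight are thus
  admissible in \<open>hausdorff_pre\<close>.\<close>

lemma hausdorff_measure_null:
  assumes s: "0 < s" and A: "hcontent s A = 0"
  shows "hausdorff_measure s A = 0"
proof -
  have "hausdorff_pre s \<delta> A = 0" if \<delta>: "0 < \<delta>" for \<delta>
  proof -
    have "hausdorff_pre s \<delta> A \<le> 0"
    proof (rule ennreal_le_epsilon)
      fix e :: real assume e: "0 < e"
      have "0 < min e (\<delta> powr s)" using e \<delta> by simp
      then have "hcontent s A < ennreal (min e (\<delta> powr s))" unfolding A by (simp only: ennreal_less_zero_iff)
      then obtain C where C: "A \<subseteq> (\<Union>i. C i)" "\<And>i::nat. bounded (C i)"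
        "(\<Sum>i. ennreal (diameter (C i) powr s)) < ennreal (min e (\<delta> powr s))"
        by (rule hcontent_less) blast
      have "diameter (C i) \<le> \<delta>" for i
      proof (rule ccontr)
        assume "\<not> diameter (C i) \<le> \<delta>"
        then have "\<delta> powr s \<le> diameter (C i) powr s" using \<delta> s by (intro powr_mono2) auto
        then have "ennreal (\<delta> powr s) \<le> ennreal (diameter (C i) powr s)" by (rule ennreal_leI)
        also have "\<dots> \<le> (\<Sum>i. ennreal (diameter (C i) powr s))"
          by (rule ennreal_le_suminf)
        also have "\<dots> < ennreal (min e (\<delta> powr s))" by (rule C(3))
        also have "\<dots> \<le> ennreal (\<delta> powr s)" by (rule ennreal_leI) simp
        finally show False by simp
      qed
      then have "hausdorff_pre s \<delta> A \<le> (\<Sum>i. ennreal (diameter (C i) powr s))"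
        unfolding hausdorff_pre_def using C(1,2) by (intro INF_lower) auto
      also have "\<dots> \<le> ennreal (min e (\<delta> powr s))" using C(3) by simp
      also have "\<dots> \<le> ennreal e" by (rule ennreal_leI) simp
      finally show "hausdorff_pre s \<delta> A \<le> 0 + ennreal e" by simp
    qed
    then show ?thesis by simp
  qed
  then show ?thesis by (simp add: hausdorff_measure_def)
qed

text \<open>The function \<open>dist p\<close> maps \<open>S\<close> onto a set containing
  \<open>{0..dist p q}\<close>, whose length bounds the sum of the diameters from below up to the
  factor 2. At scale 1 and for \<open>s < 1\<close>, each diameter is at most its
  \<open>s\<close>-th power.\<close>

lemma hausdorff_measure_connected_pos:
  fixes A :: "'a::real_normed_vector set"
  assumes s: "0 \<le> s" "s < 1" and S: "connected S" "S \<subseteq> A" "p \<in> S" "q \<in> S" "p \<noteq> q"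
  shows "hausdorff_measure s A \<noteq> 0"
proof -
  have "ennreal (dist p q / 2) \<le> hausdorff_pre s 1 A"
    unfolding hausdorff_pre_def
  proof (rule INF_greatest, elim CollectE conjE)
    fix C :: "nat \<Rightarrow> 'a set"
    assume C: "A \<subseteq> (\<Union>i. C i)" "\<forall>i. bounded (C i) \<and> diameter (C i) \<le> 1"
    \<comment> \<open>The image of \<open>C i\<close> under \<open>dist p\<close> need not be
      measurable, so it is enclosed in an interval centred at one of its values; this costs the
      factor 2.\<close>
    define L where "L i = (if C i = {} then {} else
      {dist p (SOME x. x \<in> C i) - diameter (C i)..dist p (SOME x. x \<in> C i) + diameter (C i)})" for i
    have L: "emeasure lborel (L i) \<le> ennreal (2 * diameter (C i))" "L i \<in> sets lborel" for i
      using C(2) diameter_ge_0[of "C i"] by (auto simp: L_def)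
    have "{0..dist p q} \<subseteq> (\<Union>i. L i)"
    proof
      fix t assume t: "t \<in> {0..dist p q}"
      have "connected (dist p ` S)"
        by (intro connected_continuous_image continuous_intros S)
      moreover have "dist p p \<in> dist p ` S" "dist p q \<in> dist p ` S"
        by (intro imageI S)+
      ultimately have "{dist p p..dist p q} \<subseteq> dist p ` S" by (rule connected_contains_Icc)
      then have "t \<in> dist p ` S" using t by (simp add: subset_iff)
      then obtain x where x: "x \<in> S" "t = dist p x" by blast
      then obtain i where i: "x \<in> C i" using S C by blast
      define y where "y = (SOME x. x \<in> C i)"
      have "y \<in> C i" unfolding y_def using i by (rule someI)
      then have "dist x y \<le> diameter (C i)" using i C(2) by (intro diameter_bounded_bound) auto
      moreover have "\<bar>dist p x - dist p y\<bar> \<le> dist x y"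
        using dist_triangle[of p x y] dist_triangle[of p y x] by (simp add: dist_commute)
      ultimately have "t \<in> L i" using i x by (auto simp: L_def simp flip: y_def)
      then show "t \<in> (\<Union>i. L i)" by blast
    qed
    then have "emeasure lborel {0..dist p q} \<le> emeasure lborel (\<Union>i. L i)"
      using L(2) by (intro emeasure_mono) auto
    also have "\<dots> \<le> (\<Sum>i. emeasure lborel (L i))"
      using L(2) by (intro emeasure_subadditive_countably) auto
    also have "\<dots> \<le> (\<Sum>i. ennreal 2 * ennreal (diameter (C i) powr s))"
    proof (rule suminf_le)
      fix i
      have d: "0 \<le> diameter (C i)" "diameter (C i) \<le> 1" using C(2) diameter_ge_0 by auto
      have "diameter (C i) \<le> diameter (C i) powr s"
      proof (cases "diameter (C i) = 0")
        case False
        then have "diameter (C i) powr 1 \<le> diameter (C i) powr s"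
          using d s by (intro powr_mono') auto
        then show ?thesis using d by simp
      qed simp
      then have "ennreal (2 * diameter (C i)) \<le> ennreal (2 * diameter (C i) powr s)"
        by (intro ennreal_leI) simp
      then show "emeasure lborel (L i) \<le> ennreal 2 * ennreal (diameter (C i) powr s)"
        using L(1)[of i] by (simp add: ennreal_mult)
    qed auto
    also have "\<dots> = ennreal 2 * (\<Sum>i. ennreal (diameter (C i) powr s))" by simp
    also have "emeasure lborel {0..dist p q} = ennreal 2 * ennreal (dist p q / 2)"
      by (subst ennreal_mult[symmetric]) auto
    finally show "ennreal (dist p q / 2) \<le> (\<Sum>i. ennreal (diameter (C i) powr s))"
      by (subst (asm) ennreal_mult_le_mult_iff) auto
  qed
  also have "\<dots> \<le> hausdorff_measure s A" unfolding hausdorff_measure_def by (rule SUP_upper) simp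
  finally show ?thesis using S by auto
qed

subsection \<open>Points off the endpoints\<close>

lemma norm_le_sqrt_infnorm: "norm (x :: real^'n::finite) \<le> sqrt (real CARD('n)) * infnorm x"
  using norm_le_infnorm[of x] by simp

text \<open>The 3 is fitted to counting half-beams: if \<open>x \<in> tile r\<close>, then
  \<open>2 * \<bar>r i\<bar> + 2 \<le> lat x + 3\<close> for every lateral \<open>i\<close>.\<close>

definition narrow :: "nat \<Rightarrow> nat \<Rightarrow> (real^'n::finite) set" where
  "narrow p J = {x. \<forall>k. real J \<le> ht ((wrap ^^ k) x) \<and> (lat ((wrap ^^ k) x) + 3) ^ p \<le> ht ((wrap ^^ k) x)}"

definition slab :: "('n::finite \<Rightarrow> int) \<Rightarrow> nat \<Rightarrow> (real^'n) set" where
  "slab r j = tile r \<inter> {x. real j \<le> ht x \<and> ht x \<le> real j + 1}"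

text \<open>Fixing \<open>r vert\<close> selects one index for each half-beam, so that counting
  indices counts half-beams.\<close>

definition slab_indices :: "nat \<Rightarrow> nat \<Rightarrow> ('n::finite \<Rightarrow> int) set" where
  "slab_indices p j = {r. r vert = 0 \<and> (\<forall>i. i \<noteq> vert \<longrightarrow> (2 * real_of_int \<bar>r i\<bar> + 2) ^ p \<le> real j + 1)}"

lemma wrap_narrow: "x \<in> narrow p J \<Longrightarrow> wrap x \<in> narrow p J"
  unfolding narrow_def mem_Collect_eq funpow_swap1[symmetric]
  by (rule allI, drule_tac x = "Suc k" in spec) simp

lemma narrow_ht: "x \<in> narrow p J \<Longrightarrow> real J \<le> ht x \<and> (lat x + 3) ^ p \<le> ht x"
  by (auto simp: narrow_def dest: spec[of _ 0])

lemma slab_cover: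
  assumes "x \<in> narrow p J"
  obtains j r where "J \<le> j" "r \<in> slab_indices p j" "x \<in> slab r j"
proof -
  have h: "real J \<le> ht x" "(lat x + 3) ^ p \<le> ht x" using narrow_ht[OF assms] by auto
  define j where "j = nat \<lfloor>ht x\<rfloor>"
  have j: "real j \<le> ht x" "ht x \<le> real j + 1" "J \<le> j"
    using h(1) by (auto simp: j_def le_nat_floor)
  obtain q where q: "x \<in> tile q" using tile_cover[of x] h(1) by force
  define r where "r i = (if i = vert then 0 else q i)" for i
  have r: "x \<in> tile r" using q by (simp add: tile_def r_def)
  have "r \<in> slab_indices p j"
    unfolding slab_indices_def mem_Collect_eq
  proof (intro conjI allI impI)
    show "r vert = 0" by (simp add: r_def)
    fix i :: 'a assume i: "i \<noteq> vert"
    have "\<bar>x $ i - 2 * real_of_int (r i)\<bar> \<le> 1" using r i by (simp add: tile_def)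
    then have "2 * real_of_int \<bar>r i\<bar> + 2 \<le> lat x + 3" using component_le_lat[OF i, of x] by linarith
    then have "(2 * real_of_int \<bar>r i\<bar> + 2) ^ p \<le> (lat x + 3) ^ p" by (intro power_mono) auto
    then show "(2 * real_of_int \<bar>r i\<bar> + 2) ^ p \<le> real j + 1" using h(2) j(2) by linarith
  qed
  then show thesis using that j r by (simp add: slab_def)
qed

text \<open>A coordinate has at most \<open>2 * M + 2\<close> choices, a number whose
  \<open>p\<close>-th power is at most \<open>real j + 1\<close>. Over \<open>CARD('n)\<close>
  coordinates this gives the exponent \<open>CARD('n) / p \<le> e\<close>. The assumption on
  \<open>2 ^ p\<close> makes 0 an admissible choice.\<close>

lemma slab_indices_card:
  assumes p: "0 < p" and j: "2 ^ p \<le> real j + 1" and e: "real CARD('n) \<le> e * real p"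
  shows "finite (slab_indices p j :: ('n::finite \<Rightarrow> int) set)"
    and "real (card (slab_indices p j :: ('n \<Rightarrow> int) set)) \<le> (real j + 1) powr e"
proof -
  define I where "I = {m::int. (2 * real_of_int \<bar>m\<bar> + 2) ^ p \<le> real j + 1}"
  have bnd: "real_of_int \<bar>m\<bar> \<le> real j" if "m \<in> I" for m
  proof -
    have "2 * real_of_int \<bar>m\<bar> + 2 \<le> (2 * real_of_int \<bar>m\<bar> + 2) ^ p"
      using p by (intro self_le_power) auto
    then show ?thesis using that unfolding I_def mem_Collect_eq by linarith
  qed
  have fin: "finite I"
  proof (rule finite_subset)
    show "I \<subseteq> {- int j..int j}" using bnd by force
  qed simp
  have z: "0 \<in> I" using j by (simp add: I_def)
  define M where "M = Max (abs ` I)"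
  have "M \<in> abs ` I" unfolding M_def using fin z by (intro Max_in) auto
  then have M: "0 \<le> M" "(2 * real_of_int M + 2) ^ p \<le> real j + 1" by (auto simp: I_def)
  have "I \<subseteq> {-M..M}"
  proof
    fix m assume "m \<in> I"
    then have "\<bar>m\<bar> \<le> M" unfolding M_def using fin by (intro Max_ge) auto
    then show "m \<in> {-M..M}" by auto
  qed
  then have "card I \<le> card {-M..M}" by (intro card_mono) auto
  then have "real (card I) \<le> 2 * real_of_int M + 2" using M by simp
  then have cI: "real (card I) ^ p \<le> real j + 1" using M(2) power_mono[of "real (card I)" "2 * real_of_int M + 2" p] by linarith
  have pos: "0 < real (card I)" using fin z by (auto simp: card_gt_0_iff)
  have sub: "slab_indices p j \<subseteq> (PiE UNIV (\<lambda>_. I) :: ('n \<Rightarrow> int) set)"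
  proof
    fix r :: "'n \<Rightarrow> int" assume r: "r \<in> slab_indices p j"
    have "r i \<in> I" for i
      using r z by (cases "i = vert") (auto simp: slab_indices_def I_def)
    then show "r \<in> PiE UNIV (\<lambda>_. I)" by (simp add: PiE_iff)
  qed
  have finP: "finite (PiE UNIV (\<lambda>_. I) :: ('n \<Rightarrow> int) set)" using fin by (intro finite_PiE) auto
  show "finite (slab_indices p j :: ('n \<Rightarrow> int) set)" using sub finP by (rule finite_subset)
  have "card (slab_indices p j :: ('n \<Rightarrow> int) set) \<le> card (PiE UNIV (\<lambda>_. I) :: ('n \<Rightarrow> int) set)"
    using finP sub by (rule card_mono)
  also have "\<dots> = card I ^ CARD('n)" by (simp add: card_PiE)
  finally have "real (card (slab_indices p j :: ('n \<Rightarrow> int) set)) \<le> real (card I) ^ CARD('n)"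
    by (metis of_nat_le_iff of_nat_power)
  also have "\<dots> = real (card I) powr real CARD('n)" using pos by (simp add: powr_realpow)
  also have "\<dots> \<le> real (card I) powr (real p * e)"
    using pos e by (intro powr_mono) (auto simp: mult.commute)
  also have "\<dots> = (real (card I) ^ p) powr e" using pos by (simp add: powr_powr flip: powr_realpow)
  also have "\<dots> \<le> (real j + 1) powr e"
  proof (rule powr_mono2)
    have "0 \<le> e * real p" using e by (rule order_trans[rotated]) simp
    then show "0 \<le> e" using p by (simp add: zero_le_mult_iff)
  qed (use cI in auto)
  finally show "real (card (slab_indices p j :: ('n \<Rightarrow> int) set)) \<le> (real j + 1) powr e" .
qed

lemma hcontent_slab:
  fixes r :: "'n::finite \<Rightarrow> int"
  assumes "0 \<le> s"
  shows "hcontent s (A \<inter> slab r j) \<le> ennreal ((2 * sqrt (real CARD('n))) powr s)"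
proof -
  have d: "norm (x - y) \<le> 2 * sqrt (real CARD('n))" if "x \<in> slab r j" "y \<in> slab r j" for x y
  proof -
    have "infnorm (x - y) \<le> 2"
      using that tile_diff[of x r y] by (intro infnorm_le_lat_ht) (auto simp: slab_def ht_diff)
    then have "sqrt (real CARD('n)) * infnorm (x - y) \<le> sqrt (real CARD('n)) * 2"
      by (intro mult_left_mono) auto
    then show ?thesis using norm_le_sqrt_infnorm[of "x - y"] by linarith
  qed
  have b: "bounded (A \<inter> slab r j)"
    unfolding bounded_two_points
    by (rule exI[of _ "2 * sqrt (real CARD('n))"]) (use d in \<open>auto simp: dist_norm\<close>)
  have "diameter (A \<inter> slab r j) \<le> 2 * sqrt (real CARD('n))" using d by (intro diameter_le) auto
  then have "diameter (A \<inter> slab r j) powr s \<le> (2 * sqrt (real CARD('n))) powr s"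
    using diameter_ge_0[OF b] assms by (intro powr_mono2) auto
  then show ?thesis by (rule order_trans[OF hcontent_le_diameter[OF b] ennreal_leI])
qed

text \<open>Levels are at least \<open>j\<close> on the image, so the inverse branch contracts by
  \<open>4 / j\<close> in the sup norm; the square root pays for the passage to the Euclidean
  norm.\<close>

lemma hcontent_narrow_step:
  fixes r :: "'n::finite \<Rightarrow> int" and b :: ennreal
  assumes s: "0 < s" and j: "0 < j"
    and b: "hcontent s (narrow p J \<inter> slab q j) \<le> b"
  shows "hcontent s (tile r \<inter> wrap -` (narrow p J \<inter> slab q j))
    \<le> ennreal ((4 * sqrt (real CARD('n)) / real j) powr s) * b"
proof -
  let ?n = "sqrt (real CARD('n))"
  have "hcontent s (tile r \<inter> wrap -` (narrow p J \<inter> slab q j))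
    \<le> ennreal ((4 * ?n / real j) powr s) * hcontent s (narrow p J \<inter> slab q j)"
  proof (rule hcontent_preimage_le[where f = wrap])
    fix x y :: "real^'n" assume x: "x \<in> tile r \<inter> wrap -` (narrow p J \<inter> slab q j)"
      and y: "y \<in> tile r \<inter> wrap -` (narrow p J \<inter> slab q j)"
    have "real j \<le> level (wrap x)" "real j \<le> level (wrap y)"
      using x y ht_le_level[of "wrap x"] ht_le_level[of "wrap y"] by (auto simp: slab_def)
    then have "4 / (8 + min (level (wrap x)) (level (wrap y))) \<le> 4 / real j"
      using j by (intro divide_left_mono mult_pos_pos) auto
    then have "4 / (8 + min (level (wrap x)) (level (wrap y))) * infnorm (wrap x - wrap y)
        \<le> 4 / real j * infnorm (wrap x - wrap y)"
      by (intro mult_right_mono infnorm_pos_le)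
    then have "infnorm (x - y) \<le> 4 / real j * infnorm (wrap x - wrap y)"
      by (rule order_trans[OF wrap_expanding[of x r y], rotated 2]) (use x y in auto)
    also have "\<dots> \<le> 4 / real j * norm (wrap x - wrap y)" by (intro mult_left_mono infnorm_le_norm) auto
    finally have "?n * infnorm (x - y) \<le> ?n * (4 / real j * norm (wrap x - wrap y))"
      by (intro mult_left_mono) auto
    then have "norm (x - y) \<le> ?n * (4 / real j * norm (wrap x - wrap y))"
      using norm_le_sqrt_infnorm[of "x - y"] by linarith
    also have "\<dots> = 4 * ?n / real j * dist (wrap x) (wrap y)" by (simp add: dist_norm)
    finally show "norm (x - y) \<le> 4 * ?n / real j * dist (wrap x) (wrap y)" .
  qed (use s j in auto)
  also have "\<dots> \<le> ennreal ((4 * ?n / real j) powr s) * b" using b by (intro mult_left_mono) auto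
  finally show ?thesis .
qed

text \<open>The part of \<open>narrow p J\<close> in a slab is covered by preimages of its parts in slabs of height
  \<open>m \<ge> J\<close>. There are at most about \<open>m powr e\<close> of these for each \<open>m\<close>, and each contracts by a factor
  of order \<open>1 / m\<close>. As \<open>e - s < -1\<close>, for large \<open>J\<close> any uniform bound for the contents can be halved.\<close>

lemma hcontent_narrow_null:
  assumes s: "1 < s"
  obtains p J where "0 < p" "hcontent s (narrow p J :: (real^'n::finite) set) = 0"
proof -
  let ?n = "sqrt (real CARD('n))"
  \<comment> \<open>Half of the margin: \<open>e\<close> is positive and still
    \<open>e - s < -1\<close>, so \<open>real m powr (e - s)\<close> is summable.\<close>
  define e where "e = (s - 1) / 2"
  have e: "0 < e" using s by (simp add: e_def)
  obtain p :: nat where p: "real CARD('n) / e < real p" using reals_Archimedean2 by blast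
  have p0: "0 < p" using p e by (metis divide_nonneg_pos gr0I less_le_not_le of_nat_0 of_nat_0_le_iff)
  have pe: "real CARD('n) \<le> e * real p" using p e by (simp add: pos_divide_less_eq mult.commute)
  \<comment> \<open>The first factor comes from \<open>real m + 1 \<le> 2 * real m\<close> in the
    count of half-beams, the second from the contraction.\<close>
  define c where "c = 2 powr e * (4 * ?n) powr s"
  define a where "a m = c * real m powr (e - s)" for m
  have a0: "0 \<le> a m" for m by (simp add: a_def c_def)
  have sa: "summable a"
    unfolding a_def using s by (intro summable_mult) (simp add: summable_real_powr_iff e_def field_simps)
  \<comment> \<open>Starting the heights at \<open>J \<ge> N\<close> makes the tail sum less than
    1/2, which is what halves the bound \<open>b k\<close> in each step.\<close>
  obtain N where N: "\<And>m. N \<le> m \<Longrightarrow> norm (\<Sum>i. a (i + m)) < 1 / 2"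
    using suminf_exist_split[OF _ sa, of "1 / 2"] by auto
  define J where "J = max N (2 ^ p)"
  have J: "N \<le> J" "2 ^ p \<le> J" by (simp_all add: J_def)
  have J1: "1 \<le> J" using J(2) order_trans[OF one_le_power[of "2::nat" p]] by simp
  define b where "b k = (2 * ?n) powr s * (1 / 2) ^ k" for k :: nat
  have b0: "0 \<le> b k" for k by (simp add: b_def)
  have main: "hcontent s (narrow p J \<inter> slab r j) \<le> ennreal (b k)" for r :: "'n \<Rightarrow> int" and j k
  proof (induction k arbitrary: r j)
    case 0
    then show ?case using hcontent_slab[of s "narrow p J" r j] s by (simp add: b_def)
  next
    case (Suc k)
    define B where "B m = (\<Union>q\<in>slab_indices p m. tile r \<inter> wrap -` (narrow p J \<inter> slab q m))" for m
    have B: "hcontent s (B m) \<le> ennreal (a m * b k)" if m: "J \<le> m" for m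
    proof -
      have "2 ^ p \<le> m" using J(2) m by (rule order_trans)
      then have "real (2 ^ p) \<le> real m" by (rule of_nat_mono)
      then have m2: "2 ^ p \<le> real m + 1" unfolding of_nat_power of_nat_numeral by linarith
      have m0: "0 < m" using J1 m by simp
      have fin: "finite (slab_indices p m :: ('n \<Rightarrow> int) set)"
        and card: "real (card (slab_indices p m :: ('n \<Rightarrow> int) set)) \<le> (real m + 1) powr e"
        using slab_indices_card[where 'n = 'n, OF p0 m2 pe] by auto
      have "(real m + 1) powr e \<le> (2 * real m) powr e" using m0 e by (intro powr_mono2) auto
      then have card': "real (card (slab_indices p m :: ('n \<Rightarrow> int) set)) \<le> 2 powr e * real m powr e"
        using card by (simp add: powr_mult)
      have "hcontent s (B m) \<le> (\<Sum>q\<in>slab_indices p m. hcontent s (tile r \<inter> wrap -` (narrow p J \<inter> slab q m)))"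
        unfolding B_def by (rule hcontent_UN_finite[OF fin])
      also have "\<dots> \<le> (\<Sum>q\<in>(slab_indices p m :: ('n \<Rightarrow> int) set). ennreal ((4 * ?n / real m) powr s) * ennreal (b k))"
        using s by (intro sum_mono hcontent_narrow_step Suc m0) simp
      also have "\<dots> = ennreal (real (card (slab_indices p m :: ('n \<Rightarrow> int) set)) * ((4 * ?n / real m) powr s * b k))"
        using b0 by (simp add: ennreal_mult ennreal_of_nat_eq_real_of_nat)
      also have "\<dots> \<le> ennreal (a m * b k)"
      proof (rule ennreal_leI)
        have "real (card (slab_indices p m :: ('n \<Rightarrow> int) set)) * (4 * ?n / real m) powr s
            \<le> 2 powr e * real m powr e * (4 * ?n / real m) powr s"
          using card' by (rule mult_right_mono) simp
        also have "\<dots> = 2 powr e * real m powr e * ((4 * ?n) powr s * real m powr (- s))"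
          by (simp add: powr_divide powr_minus_divide)
        also have "\<dots> = a m"
          using powr_add[of "real m" e "- s"] by (simp add: a_def c_def)
        finally have "real (card (slab_indices p m :: ('n \<Rightarrow> int) set)) * (4 * ?n / real m) powr s * b k \<le> a m * b k"
          using b0 by (rule mult_right_mono)
        then show "real (card (slab_indices p m :: ('n \<Rightarrow> int) set)) * ((4 * ?n / real m) powr s * b k) \<le> a m * b k"
          by (simp only: mult.assoc)
      qed
      finally show ?thesis .
    qed
    have "narrow p J \<inter> slab r j \<subseteq> (\<Union>i. B (i + J))"
    proof
      fix x assume x: "x \<in> narrow p J \<inter> slab r j"
      obtain m q where m: "J \<le> m" "q \<in> slab_indices p m" "wrap x \<in> slab q m"
        using slab_cover[OF wrap_narrow[OF IntD1[OF x]]] .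
      then have "x \<in> B (m - J + J)" using x wrap_narrow by (auto simp: B_def slab_def[of r])
      then show "x \<in> (\<Union>i. B (i + J))" by blast
    qed
    then have "hcontent s (narrow p J \<inter> slab r j) \<le> (\<Sum>i. hcontent s (B (i + J)))"
      by (rule order_trans[OF hcontent_mono hcontent_UN])
    also have "\<dots> \<le> (\<Sum>i. ennreal (a (i + J) * b k))" by (intro suminf_le B) auto
    also have "\<dots> = ennreal ((\<Sum>i. a (i + J)) * b k)"
    proof (rule suminf_ennreal_eq)
      have "summable (\<lambda>i. a (i + J))" using sa by (simp add: summable_iff_shift)
      then show "(\<lambda>i. a (i + J) * b k) sums ((\<Sum>i. a (i + J)) * b k)" by (intro sums_mult2 summable_sums)
    qed (use a0 b0 in simp)
    also have "\<dots> \<le> ennreal (1 / 2 * b k)"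
      using N[OF J(1)] b0 by (intro ennreal_leI mult_right_mono) auto
    finally show ?case by (simp add: b_def)
  qed
  have lim: "b \<longlonglongrightarrow> 0" unfolding b_def by (intro tendsto_mult_right_zero LIMSEQ_power_zero) simp
  have null: "hcontent s (narrow p J \<inter> slab r j) = 0" for r :: "'n \<Rightarrow> int" and j
  proof -
    have "hcontent s (narrow p J \<inter> slab r j) \<le> ennreal 0"
      by (rule LIMSEQ_le_const[OF tendsto_ennrealI[OF lim]]) (use main in blast)
    then show ?thesis by simp
  qed
  have "(narrow p J :: (real^'n) set) \<subseteq> (\<Union>(r, j)\<in>UNIV. narrow p J \<inter> slab r j)"
  proof
    fix x :: "real^'n" assume x: "x \<in> narrow p J"
    obtain j r where "x \<in> slab r j" using slab_cover[OF x] .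
    then show "x \<in> (\<Union>(r, j)\<in>UNIV. narrow p J \<inter> slab r j)" using x by auto
  qed
  moreover have "hcontent s (\<Union>(r, j)\<in>UNIV. narrow p J \<inter> (slab r j :: (real^'n) set)) = 0"
    by (rule hcontent_null_UN) (use null in auto)
  ultimately have "hcontent s (narrow p J :: (real^'n) set) = 0"
    by (rule hcontent_null_subset)
  then show thesis using that p0 by blast
qed

text \<open>There are countably many half-beams, and on each of them \<open>wrap\<close> does not
  shrink sup-norm distances, so null sets pull back to null sets.\<close>

lemma hcontent_wrap_vimage_null:
  fixes A :: "(real^'n::finite) set"
  assumes s: "0 \<le> s" and A: "hcontent s A = 0"
  shows "hcontent s {x. 0 \<le> ht x \<and> (wrap ^^ k) x \<in> A} = 0"
proof (induction k)
  case 0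
  have "hcontent s {x. 0 \<le> ht x \<and> (wrap ^^ 0) x \<in> A} \<le> hcontent s A" by (rule hcontent_mono) auto
  then show ?case using A by simp
next
  case (Suc k)
  let ?P = "{x. 0 \<le> ht x \<and> (wrap ^^ k) x \<in> A}"
  have "hcontent s (tile r \<inter> wrap -` ?P) = 0" for r
  proof (rule hcontent_null_preimage[where f = wrap and K = "sqrt (real CARD('n))", OF _ s _ _ Suc])
    fix x y :: "real^'n" assume xy: "x \<in> tile r \<inter> wrap -` ?P" "y \<in> tile r \<inter> wrap -` ?P"
    have "infnorm (x - y) \<le> infnorm (wrap x - wrap y)"
      using wrap_expanding2[of x r y] xy infnorm_pos_le[of "x - y"] by auto
    also have "\<dots> \<le> norm (wrap x - wrap y)" by (rule infnorm_le_norm)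
    finally have "sqrt (real CARD('n)) * infnorm (x - y) \<le> sqrt (real CARD('n)) * norm (wrap x - wrap y)"
      by (intro mult_left_mono) auto
    then show "norm (x - y) \<le> sqrt (real CARD('n)) * dist (wrap x) (wrap y)"
      using norm_le_sqrt_infnorm[of "x - y"] unfolding dist_norm by linarith
  qed auto
  then have "hcontent s (\<Union>r. tile r \<inter> wrap -` ?P) = 0" by (intro hcontent_null_UN) auto
  moreover have "{x. 0 \<le> ht x \<and> (wrap ^^ Suc k) x \<in> A} \<subseteq> (\<Union>r. tile r \<inter> wrap -` ?P)"
    using tile_cover ht_wrap_nonneg by (fastforce simp: funpow_Suc_right simp del: funpow.simps)
  ultimately show ?case by (rule hcontent_null_subset[rotated])
qed

lemma growth_pot_le_level:
  assumes "0 \<le> ht x" shows "(growth ^^ k) (pot x) \<le> level ((wrap ^^ k) x)"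
proof (rule ccontr)
  assume less: "\<not> (growth ^^ k) (pot x) \<le> level ((wrap ^^ k) x)"
  obtain t where t: "0 \<le> t" "(growth ^^ k) t = level ((wrap ^^ k) x)"
    using growth_iter_surj level_nonneg[OF ht_iter_nonneg[OF assms]] by blast
  have "pot x \<le> t" using t by (intro pot_le[of _ k]) auto
  then have "(growth ^^ k) (pot x) \<le> (growth ^^ k) t" by simp
  then show False using less t by simp
qed

text \<open>First stage of the amplification: one step turns the additive gap \<open>c\<close> into
  the factor \<open>1 + c\<close>, because
  \<open>growth (a + c) \<ge> exp c * growth a\<close>.\<close>

lemma growth_superlinear:
  assumes ab: "0 \<le> a" "a + c \<le> b" and c: "0 \<le> c"
  shows "(1 + c) * growth a \<le> growth b"
proof -
  have "growth (a + c) - exp c * growth a = 8 * (exp c - 1)"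
    by (simp add: growth_def exp_add algebra_simps)
  moreover have "0 \<le> 8 * (exp c - 1)" using c by simp
  ultimately have "exp c * growth a \<le> growth (a + c)" by linarith
  also have "\<dots> \<le> growth b" using ab by simp
  finally have "exp c * growth a \<le> growth b" .
  moreover have "(1 + c) * growth a \<le> exp c * growth a"
    using exp_ge_add_one_self[of c] ab by (intro mult_right_mono) (auto simp: growth_def)
  ultimately show ?thesis by linarith
qed

text \<open>Second stage: one step turns the factor \<open>2 * p\<close> into the exponent
  \<open>p\<close>, because \<open>growth a + 13 \<le> exp (2 * a)\<close>.\<close>

lemma growth_superpolynomial:
  assumes p: "0 < p" and a: "3 \<le> a" and b: "2 * real p * a \<le> b"
  shows "(growth a + 13) ^ p \<le> growth b"
proof -
  have a9: "9 \<le> exp a"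
  proof -
    have "1 + a / 2 + (a / 2) ^ 2 / 2 \<le> exp (a / 2)" using a by (intro exp_lower_Taylor_quadratic) auto
    moreover have "3 / 2 * (3 / 2) \<le> a / 2 * (a / 2)" using a by (intro mult_mono) auto
    ultimately have "3 \<le> exp (a / 2)" using a by (simp add: power2_eq_square)
    then have "3 * 3 \<le> exp (a / 2) * exp (a / 2)" by (intro mult_mono) auto
    then show ?thesis by (simp flip: exp_add)
  qed
  have "8 * (y - 1) + 13 \<le> y\<^sup>2" if "9 \<le> y" for y :: real
  proof -
    have eq: "y\<^sup>2 - (8 * (y - 1) + 13) = (y - 9)\<^sup>2 + 10 * (y - 9) + 4"
      by (simp add: power2_eq_square algebra_simps)
    have "0 \<le> (y - 9)\<^sup>2 + 10 * (y - 9) + 4"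
      using that by (intro add_nonneg_nonneg) auto
    then have "0 \<le> y\<^sup>2 - (8 * (y - 1) + 13)" by (simp only: eq)
    then show ?thesis by (simp only: diff_ge_0_iff_ge)
  qed
  from this[OF a9] have le: "growth a + 13 \<le> exp (2 * a)" by (simp add: growth_def exp_double)
  have "0 \<le> growth a" using a by (simp add: growth_def)
  then have "(growth a + 13) ^ p \<le> exp (2 * a) ^ p" using le by (intro power_mono) auto
  also have "\<dots> = exp (2 * real p * a)" by (simp add: mult.commute mult.left_commute flip: exp_of_nat_mult)
  finally have 1: "(growth a + 13) ^ p \<le> exp (2 * real p * a)" .
  have "1 * a \<le> 2 * real p * a" using p a by (intro mult_right_mono) auto
  then have "exp a \<le> exp (2 * real p * a)" by simp
  also have "\<dots> \<le> exp b" using b by simp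
  finally have "9 \<le> exp b" by (rule order_trans[OF a9])
  then have "exp b \<le> growth b" by (simp add: growth_def)
  moreover have "exp (2 * real p * a) \<le> exp b" using b by simp
  ultimately have "exp (2 * real p * a) \<le> growth b" by (rule order_trans[rotated])
  then show ?thesis by (rule order_trans[OF 1])
qed

text \<open>Up to a constant, \<open>(growth ^^ k) u\<close> bounds the lateral position of the
  orbit of \<open>z\<close>, hence also that of \<open>x\<close>, while \<open>x\<close> reaches
  height \<open>(growth ^^ k) (pot x)\<close>. Two steps amplify the additive gap between these to a
  power, whence \<open>Suc (Suc K)\<close>.\<close>

lemma eventually_narrow:
  assumes x: "x \<in> itin s" and z: "z \<in> itin s" and less: "pot z < pot x" and p: "0 < p"
  shows "\<exists>k. (wrap ^^ k) x \<in> narrow p J"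
proof -
  note hx = itin_ht[OF x] note hz = itin_ht[OF z]
  obtain u where u: "pot z < u" "u < pot x" using less dense by blast
  have u0: "0 < u" using pot_nonneg[OF hz] u by simp
  define a b where "a k = (growth ^^ k) u" and "b k = (growth ^^ k) (pot x)" for k
  have g0: "(growth ^^ k) 0 = 0" for k by (induction k) (auto simp: growth_def)
  obtain k1 where k1: "\<And>k. k1 \<le> k \<Longrightarrow> level ((wrap ^^ k) z) < a k"
    using pot_less_imp[OF hz u(1)] by (auto simp: a_def)
  \<comment> \<open>\<open>2 * real p\<close> feeds \<open>growth_superlinear\<close>; 13 is the
    lateral slack 10 plus the 3 from \<open>narrow\<close>.\<close>
  have "eventually (\<lambda>k. a k + (2 * real p + 13) \<le> b k) sequentially"
    unfolding a_def b_def using u u0 by (intro eventually_growth_gap) auto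
  then obtain k2 where k2: "\<And>k. k2 \<le> k \<Longrightarrow> a k + (2 * real p + 13) \<le> b k"
    unfolding eventually_sequentially by blast
  have "eventually (\<lambda>k. (growth ^^ k) 0 + (real J + 3) \<le> a k) sequentially"
    unfolding a_def using u0 by (intro eventually_growth_gap) auto
  then obtain k3 where k3: "\<And>k. k3 \<le> k \<Longrightarrow> real J + 3 \<le> a k"
    unfolding eventually_sequentially g0 by auto
  define K where "K = k1 + k2 + k3"
  have main: "real J \<le> ht ((wrap ^^ k) x) \<and> (lat ((wrap ^^ k) x) + 3) ^ p \<le> ht ((wrap ^^ k) x)"
    if "Suc (Suc K) \<le> k" for k
  proof -
    define m where "m = k - 2"
    have k: "k = Suc (Suc m)" "K \<le> m" using that by (auto simp: m_def)
    have am: "0 \<le> a m" "0 \<le> a (Suc m)" "0 \<le> a k"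
      unfolding a_def using u0 by (intro growth_iter_nonneg; simp)+
    have "a m + (2 * real p) \<le> b m" using k2[of m] k by (simp add: K_def)
    then have "(1 + 2 * real p) * growth (a m) \<le> growth (b m)" using am by (intro growth_superlinear) auto
    then have "(1 + 2 * real p) * a (Suc m) \<le> b (Suc m)" by (simp add: a_def b_def)
    then have "2 * real p * a (Suc m) \<le> b (Suc m)" using am by (simp add: distrib_right)
    moreover have "3 \<le> a (Suc m)" using k3[of "Suc m"] k by (simp add: K_def)
    ultimately have "(growth (a (Suc m)) + 13) ^ p \<le> growth (b (Suc m))"
      by (intro growth_superpolynomial p)
    then have pow: "(a k + 13) ^ p \<le> b k" by (simp add: a_def b_def k)
    have "lat ((wrap ^^ k) z) - 8 \<le> level ((wrap ^^ k) z)" by (simp add: level_def)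
    also have "\<dots> < a k" using k1[of k] k by (simp add: K_def)
    finally have lat: "lat ((wrap ^^ k) x) \<le> a k + 10" using lat_itin_diff[OF x z, of k] by simp
    have gap: "a k + 13 \<le> b k" using k2[of k] k by (simp add: K_def)
    have "b k \<le> level ((wrap ^^ k) x)" unfolding b_def by (rule growth_pot_le_level[OF hx])
    \<comment> \<open>The lateral term of the level is at most \<open>a k + 2\<close>, which is less
      than \<open>b k\<close>, so only the height can account for the level.\<close>
    then have ht: "b k \<le> ht ((wrap ^^ k) x)" using lat gap by (simp add: level_def le_max_iff_disj)
    have "(lat ((wrap ^^ k) x) + 3) ^ p \<le> (a k + 13) ^ p" using lat by (intro power_mono) auto
    then show ?thesis using pow ht gap k3[of k] k by (simp add: K_def)
  qed
  have "(wrap ^^ Suc (Suc K)) x \<in> narrow p J"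
    unfolding narrow_def mem_Collect_eq
  proof
    fix k
    have e: "(wrap ^^ k) ((wrap ^^ Suc (Suc K)) x) = (wrap ^^ (k + Suc (Suc K))) x"
      by (simp only: funpow_add o_apply)
    show "real J \<le> ht ((wrap ^^ k) ((wrap ^^ Suc (Suc K)) x)) \<and>
        (lat ((wrap ^^ k) ((wrap ^^ Suc (Suc K)) x)) + 3) ^ p \<le> ht ((wrap ^^ k) ((wrap ^^ Suc (Suc K)) x))"
      unfolding e by (rule main) simp
  qed
  then show ?thesis by blast
qed

section \<open>Reflection into the lower half-space and the whole family of hairs\<close>

definition mirror :: "real^'n::finite \<Rightarrow> real^'n" where
  "mirror x = (\<chi> i. if i = vert then - x $ i else x $ i)"

lemma mirror_mirror [simp]: "mirror (mirror x) = x"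
  by (simp add: mirror_def vec_eq_iff)

lemma ht_mirror [simp]: "ht (mirror x) = - ht x"
  by (simp add: mirror_def ht_def)

lemma mirror_id: "ht x = 0 \<Longrightarrow> mirror x = x"
  by (simp add: mirror_def ht_def vec_eq_iff)

lemma mirror_diff: "mirror x - mirror y = mirror (x - y)"
  by (simp add: mirror_def vec_eq_iff)

lemma norm_mirror [simp]: "norm (mirror x) = norm x"
  unfolding norm_vec_def by (rule L2_set_cong) (simp_all add: mirror_def)

lemma continuous_on_mirror: "continuous_on S (mirror :: real^'n::finite \<Rightarrow> _)"
proof (rule lipschitz_on_continuous_on)
  show "1-lipschitz_on S (mirror :: real^'n \<Rightarrow> _)"
    by (rule lipschitz_onI) (simp_all add: dist_norm mirror_diff)
qed

lemma hair_mirror: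
  assumes "hair_with_endpoint H p" shows "hair_with_endpoint (mirror ` H) (mirror p)"
proof -
  obtain g where g: "hair_param g" "g ` {0..} = H" "g 0 = p"
    using assms by (auto simp: hair_with_endpoint_def)
  have "hair_param (mirror \<circ> g)"
    unfolding hair_param_def
  proof (intro conjI)
    show "continuous_on {0..} (mirror \<circ> g)"
      using g(1) continuous_on_mirror by (intro continuous_on_compose) (auto simp: hair_param_def)
    show "inj_on (mirror \<circ> g) {0..}"
      using g(1) by (intro comp_inj_on) (auto simp: hair_param_def intro!: inj_on_inverseI[of _ mirror])
    show "filterlim (\<lambda>t. norm ((mirror \<circ> g) t)) at_top at_top"
      using g(1) by (simp add: hair_param_def)
  qed
  then show ?thesis
    unfolding hair_with_endpoint_def using g(2,3) by (intro exI[of _ "mirror \<circ> g"]) auto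
qed

definition upward :: "real^'n::finite \<Rightarrow> real^'n" where
  "upward x = (if 0 \<le> ht x then x else mirror x)"

lemma upward_itin: "x \<in> itin s \<Longrightarrow> upward x = x"
  by (simp add: upward_def itin_ht)

lemma upward_mirror_itin: "x \<in> itin s \<Longrightarrow> upward (mirror x) = x"
  using itin_ht[of x s] by (auto simp: upward_def mirror_id)

text \<open>A family of sets, not indexed by itineraries, so that sequences describing the same
  points yield a single hair.\<close>

definition hairs :: "(real^'n::finite) set set" where
  "hairs = {H. \<exists>s. itin s \<noteq> {} \<and> (H = itin s \<or> H = mirror ` itin s)}"

lemma hairs_cases:
  assumes "H \<in> hairs"
  obtains s where "itin s \<noteq> {}" "upward ` H = itin s" "inj_on upward H" "H = itin s \<or> H = mirror ` itin s"
proof -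
  obtain s where s: "itin s \<noteq> {}" "H = itin s \<or> H = mirror ` itin s"
    using assms by (auto simp: hairs_def)
  have "upward ` H = itin s"
    using s(2) by (auto simp: image_image upward_itin upward_mirror_itin)
  moreover have "inj_on upward H"
    using s(2)
  proof
    assume "H = itin s" then show ?thesis by (intro inj_onI) (simp add: upward_itin)
  next
    assume "H = mirror ` itin s"
    then show ?thesis by (intro inj_on_inverseI[of _ mirror]) (auto simp: upward_mirror_itin)
  qed
  ultimately show thesis using that s by blast
qed

lemma hairs_endpoint:
  assumes "H \<in> hairs"
  obtains p where "hair_with_endpoint H p" "p \<in> H" "\<And>x. x \<in> H \<Longrightarrow> pot (upward p) \<le> pot (upward x)"
proof -
  obtain s where s: "itin s \<noteq> {}" "upward ` H = itin s" "inj_on upward H" "H = itin s \<or> H = mirror ` itin s"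
    by (rule hairs_cases[OF assms]) blast
  obtain q where q: "q \<in> itin s" "\<And>x. x \<in> itin s \<Longrightarrow> pot q \<le> pot x" "hair_with_endpoint (itin s) q"
    by (rule itin_hair[OF s(1)]) blast
  define p where "p = (if H = itin s then q else mirror q)"
  have "hair_with_endpoint H p"
    using s(4) hair_mirror[OF q(3)] q(3) by (auto simp: p_def)
  moreover have "p \<in> H" using s(4) q(1) by (auto simp: p_def)
  moreover have "upward p = q" using q(1) by (simp add: p_def upward_itin upward_mirror_itin)
  then have "pot (upward p) \<le> pot (upward x)" if "x \<in> H" for x
    using q(2) s(2) that by auto
  ultimately show thesis by (rule that)
qed

lemma pot_upward_inj:
  assumes "H \<in> hairs" shows "inj_on (\<lambda>x. pot (upward x)) H"
proof -
  obtain s where "upward ` H = itin s" "inj_on upward H" by (rule hairs_cases[OF assms]) blast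
  then show ?thesis using comp_inj_on[of upward H pot] pot_inj[of s] by (simp add: o_def)
qed

text \<open>Either the itinerary sets differ, and the orbit hits a wall, or the hairs are mirror
  images of each other and meet only in the hyperplane \<open>ht = 0\<close>.\<close>

lemma pot_upward_common:
  assumes "H1 \<in> hairs" "H2 \<in> hairs" "H1 \<noteq> H2" "x \<in> H1" "x \<in> H2"
  shows "pot (upward x) = 0"
proof -
  obtain s1 where s1: "upward ` H1 = itin s1" "H1 = itin s1 \<or> H1 = mirror ` itin s1"
    by (rule hairs_cases[OF assms(1)]) blast
  obtain s2 where s2: "upward ` H2 = itin s2" "H2 = itin s2 \<or> H2 = mirror ` itin s2"
    by (rule hairs_cases[OF assms(2)]) blast
  have x: "upward x \<in> itin s1" "upward x \<in> itin s2" using s1(1) s2(1) assms(4,5) by auto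
  show ?thesis
  proof (cases "itin s1 = itin s2")
    case False
    then show ?thesis using pot_zero_if_common x by blast
  next
    case True
    then have "x \<in> itin s1 \<and> x \<in> mirror ` itin s1" using s1(2) s2(2) assms(3-5) by auto
    then have "0 \<le> ht x" "ht x \<le> 0" using itin_ht by auto
    then have "ht (upward x) = 0" by (simp add: upward_def)
    then show ?thesis using pot_zero_if_ht_zero[of "upward x" 0] by simp
  qed
qed

lemma Union_hairs: "\<Union>hairs = UNIV"
proof (intro equalityI subsetI UNIV_I)
  fix x :: "real^'a"
  show "x \<in> \<Union>hairs"
  proof (cases "0 \<le> ht x")
    case True
    then obtain s where "x \<in> itin s" using itin_cover by blast
    then show ?thesis by (intro UnionI[of "itin s"]) (auto simp: hairs_def)
  next
    case False
    then obtain s where s: "mirror x \<in> itin s" using itin_cover[of "mirror x"] by auto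
    then have "x \<in> mirror ` itin s" by (intro image_eqI[of _ _ "mirror x"]) auto
    then show ?thesis using s by (intro UnionI[of "mirror ` itin s"]) (auto simp: hairs_def)
  qed
qed

theorem theorem1:
  assumes "CARD('n::finite) \<ge> 2"
  shows "\<exists>(F :: (real^'n) set set) (ep :: (real^'n) set \<Rightarrow> real^'n).
           (\<forall>H\<in>F. hair_with_endpoint H (ep H)) \<and>
           \<Union>F = UNIV \<and>
           (\<forall>H1\<in>F. \<forall>H2\<in>F. H1 \<noteq> H2 \<longrightarrow>
               H1 \<inter> H2 = {} \<or> (H1 \<inter> H2 = {ep H1} \<and> ep H1 = ep H2)) \<and>
           hausdorff_dim (\<Union>H\<in>F. H - {ep H}) = 1"
proof -
  let ?F = "hairs :: (real^'n) set set"
  have "\<forall>H\<in>?F. \<exists>p. hair_with_endpoint H p \<and> p \<in> H \<and> (\<forall>x\<in>H. pot (upward p) \<le> pot (upward x))"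
  proof
    fix H assume "H \<in> ?F"
    then obtain p where "hair_with_endpoint H p" "p \<in> H" "\<And>x. x \<in> H \<Longrightarrow> pot (upward p) \<le> pot (upward x)"
      by (rule hairs_endpoint) blast
    then show "\<exists>p. hair_with_endpoint H p \<and> p \<in> H \<and> (\<forall>x\<in>H. pot (upward p) \<le> pot (upward x))"
      by blast
  qed
  from bchoice[OF this] obtain ep where "\<forall>H\<in>?F. hair_with_endpoint H (ep H) \<and> ep H \<in> H \<and>
      (\<forall>x\<in>H. pot (upward (ep H)) \<le> pot (upward x))" ..
  then have ep: "\<And>H. H \<in> ?F \<Longrightarrow> hair_with_endpoint H (ep H)" "\<And>H. H \<in> ?F \<Longrightarrow> ep H \<in> H"
    "\<And>H x. H \<in> ?F \<Longrightarrow> x \<in> H \<Longrightarrow> pot (upward (ep H)) \<le> pot (upward x)" by simp_all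
  have "0 \<le> ht (upward x)" for x :: "real^'n" by (simp add: upward_def)
  then have nn: "0 \<le> pot (upward x)" for x :: "real^'n" by (rule pot_nonneg)
  \<comment> \<open>The potential is nonnegative and minimal at the endpoint, so by injectivity a
    point of potential 0 is the endpoint.\<close>
  have common: "x = ep H1" if "H1 \<in> ?F" "H2 \<in> ?F" "H1 \<noteq> H2" "x \<in> H1" "x \<in> H2" for H1 H2 x
  proof -
    have "pot (upward x) = 0" by (rule pot_upward_common[OF that])
    then have "pot (upward (ep H1)) = pot (upward x)" using ep(3)[OF that(1,4)] nn[of "ep H1"] by simp
    then show ?thesis using inj_onD[OF pot_upward_inj[OF that(1)], of "ep H1" x] that(4) ep(2)[OF that(1)] by simp
  qed
  have inter: "H1 \<inter> H2 = {} \<or> (H1 \<inter> H2 = {ep H1} \<and> ep H1 = ep H2)"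
    if "H1 \<in> ?F" "H2 \<in> ?F" "H1 \<noteq> H2" for H1 H2
  proof (cases "H1 \<inter> H2 = {}")
    case False
    then obtain x where x: "x \<in> H1" "x \<in> H2" by blast
    have e: "x = ep H1" "x = ep H2"
      by (rule common[OF that x], rule common[OF that(2,1) that(3)[symmetric] x(2,1)])
    have "H1 \<inter> H2 \<subseteq> {ep H1}" using common[OF that] by auto
    then have "H1 \<inter> H2 = {ep H1}" using x unfolding e(1) by auto
    moreover have "ep H1 = ep H2" by (rule trans[OF e(1)[symmetric] e(2)])
    ultimately show ?thesis by (intro disjI2 conjI)
  qed simp
  define N where "N = (\<Union>H\<in>?F. H - {ep H})"
  have upper: "hausdorff_measure s N = 0" if s: "1 < s" for s
  proof (rule hausdorff_measure_null)
    obtain p J where p: "0 < p" "hcontent s (narrow p J :: (real^'n) set) = 0"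
      using hcontent_narrow_null[OF s] .
    define W where "W k = {x :: real^'n. 0 \<le> ht x \<and> (wrap ^^ k) x \<in> narrow p J}" for k
    have W: "hcontent s (W k) = 0" for k
      unfolding W_def by (rule hcontent_wrap_vimage_null) (use s p in auto)
    have mW: "hcontent s (mirror ` W k) = 0" for k
    proof (rule hcontent_null_preimage[where f = mirror and K = 1])
      show "norm (x - y) \<le> 1 * dist (mirror x) (mirror y)" for x y :: "real^'n"
        by (simp add: dist_norm mirror_diff)
    qed (use s W[of k] in auto)
    have "N \<subseteq> (\<Union>k. W k \<union> mirror ` W k)"
    proof
      fix x assume "x \<in> N"
      then obtain H where H: "H \<in> ?F" "x \<in> H" "x \<noteq> ep H" by (auto simp: N_def)
      obtain s' where s': "upward ` H = itin s'" by (rule hairs_cases[OF H(1)]) blast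
      have i: "upward x \<in> itin s'" "upward (ep H) \<in> itin s'" using s' H(2) ep(2)[OF H(1)] by auto
      have "pot (upward (ep H)) \<noteq> pot (upward x)"
        using inj_onD[OF pot_upward_inj[OF H(1)], of "ep H" x] H(2,3) ep(2)[OF H(1)] by auto
      then have "pot (upward (ep H)) < pot (upward x)" using ep(3)[OF H(1,2)] by simp
      then obtain k where "(wrap ^^ k) (upward x) \<in> narrow p J"
        using eventually_narrow[OF i] p(1) by blast
      then have "upward x \<in> W k" using itin_ht[OF i(1)] by (simp add: W_def)
      then have "x \<in> W k \<union> mirror ` W k"
        by (cases "0 \<le> ht x") (auto simp: upward_def intro: image_eqI[of _ _ "mirror x"])
      then show "x \<in> (\<Union>k. W k \<union> mirror ` W k)" by blast
    qed
    moreover have "hcontent s (W k \<union> mirror ` W k) = 0" for k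
      using hcontent_Un[of s "W k" "mirror ` W k"] W mW by simp
    then have "hcontent s (\<Union>k. W k \<union> mirror ` W k) = 0" by (intro hcontent_null_UN) auto
    ultimately show "hcontent s N = 0" by (rule hcontent_null_subset)
  qed (use s in simp)
  have lower: "hausdorff_measure s N \<noteq> 0" if s: "0 \<le> s" "s < 1" for s
  proof -
    obtain H where H: "H \<in> ?F" using Union_hairs[where 'a = 'n] by blast
    obtain g where g: "hair_param g" "g ` {0..} = H" "g 0 = ep H"
      using ep(1)[OF H] by (auto simp: hair_with_endpoint_def)
    have inj: "inj_on g {0..}" using g(1) by (simp add: hair_param_def)
    \<comment> \<open>The endpoint is \<open>g 0\<close>, so the arc over \<open>{1..2}\<close> is a
      nondegenerate connected subset of \<open>N\<close>.\<close>
    have ne: "g t \<noteq> ep H" if "t \<in> {1..2}" for t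
      using inj_onD[OF inj, of t 0] that g(3) by auto
    show ?thesis
    proof (rule hausdorff_measure_connected_pos[OF s])
      have "continuous_on {0..} g" using g(1) by (simp add: hair_param_def)
      then have "continuous_on {1..2} g" by (rule continuous_on_subset) auto
      then show "connected (g ` {1..2})" by (rule connected_continuous_image) (rule connected_Icc)
      show "g ` {1..2} \<subseteq> N"
      proof
        fix x assume "x \<in> g ` {1..2}"
        then obtain t where t: "t \<in> {1..2}" "x = g t" by blast
        then have "x \<in> H" unfolding g(2)[symmetric] by auto
        then show "x \<in> N" using H ne[OF t(1)] t(2) by (auto simp: N_def)
      qed
      show "g 1 \<in> g ` {1..2}" "g 2 \<in> g ` {1..2}" by (rule imageI; simp)+
      show "g 1 \<noteq> g 2" using inj_onD[OF inj, of 1 2] by auto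
    qed
  qed
  have "hausdorff_dim N = 1"
    unfolding hausdorff_dim_def
  proof (rule antisym)
    show "Inf (ereal ` {s. 0 \<le> s \<and> hausdorff_measure s N = 0}) \<le> 1"
    proof (rule dense_ge)
      fix y :: ereal assume "1 < y"
      then obtain s where s: "1 < ereal s" "ereal s < y" using ereal_dense2 by blast
      then have "Inf (ereal ` {s. 0 \<le> s \<and> hausdorff_measure s N = 0}) \<le> ereal s"
        using upper[of s] by (intro Inf_lower imageI) (auto simp: one_ereal_def)
      then show "Inf (ereal ` {s. 0 \<le> s \<and> hausdorff_measure s N = 0}) \<le> y" using s by simp
    qed
    show "1 \<le> Inf (ereal ` {s. 0 \<le> s \<and> hausdorff_measure s N = 0})"
    proof (rule Inf_greatest)
      fix y assume "y \<in> ereal ` {s. 0 \<le> s \<and> hausdorff_measure s N = 0}"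
      then obtain s where "y = ereal s" "0 \<le> s" "hausdorff_measure s N = 0" by blast
      then show "1 \<le> y" using lower[of s] by (auto simp: one_ereal_def not_less[symmetric])
    qed
  qed
  then show ?thesis
    unfolding N_def using ep(1) Union_hairs inter by (intro exI[of _ ?F] exI[of _ ep]) simp
qed

end
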